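(* Let $p$ be a prime and let $X$ be a simply-connected $p$-local CW-complex whose homology groups are finitely generated over $\mathbb{Z}_p$ in each dimension. Then $N^\ast\mathcal{E}(X;p)=N_\ast\mathcal{E}(X;p)$.
   Context: $\mathbb{Z}_p$ denotes the integers localized at $p$ and $\mathbb{Z}/p$ the integers modulo $p$. $[X,X]$ is the set of based homotopy classes of based self-maps and $\mathcal{E}(X)\subseteq[X,X]$ the group of self-homotopy equivalences; (co)homology is reduced. $\mathcal{A}^\ast_k(X;p)=\{f\in[X,X]: f^\ast\colon H^i(X;\mathbb{Z}/p)\to H^i(X;\mathbb{Z}/p)\text{ is an isomorphism for all } i\leq k\}$ and $\mathcal{A}_\ast^k(X;p)=\{f\in[X,X]: f_\ast\colon H_i(X;\mathbb{Z}/p)\to H_i(X;\mathbb{Z}/p)\text{ is an isomorphism for all } i\leq k\}$. The mod-$p$ cohomology and homology self-closeness numbers are $N^\ast\mathcal{E}(X;p)=\min\{k\geq 0:\mathcal{A}^\ast_k(X;p)=\mathcal{E}(X)\}$ and $N_\ast\mathcal{E}(X;p)=\min\{k\geq 0:\mathcal{A}_\ast^k(X;p)=\mathcal{E}(X)\}$ ($+\infty$ if there is no such $k$). *)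

theory Defs
  imports "HOL-Homology.Homology" "HOL-Library.Extended_Nat"
    "HOL-Algebra.Product_Groups" "HOL-Algebra.Module" "HOL-Computational_Algebra.Primes"
begin

section \<open>CW complexes\<close>

definition disc :: "nat \<Rightarrow> (nat \<Rightarrow> real) topology" where
  "disc n = subtopology (Euclidean_space n) {x. (\<Sum>i<n. (x i)\<^sup>2) \<le> 1}"

definition open_disc :: "nat \<Rightarrow> (nat \<Rightarrow> real) set" where
  "open_disc n = {x \<in> topspace (disc n). (\<Sum>i<n. (x i)\<^sup>2) < 1}"

definition disc_boundary :: "nat \<Rightarrow> (nat \<Rightarrow> real) set" where
  "disc_boundary n = {x \<in> topspace (disc n). (\<Sum>i<n. (x i)\<^sup>2) = 1}"

text \<open>
  \<open>\<E>\<close> is the set of open cells, \<open>d e\<close> the dimension of the cell \<open>e\<close> and \<open>\<Phi> e\<close> its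
  characteristic map. In the weak topology condition only one implication is required, the
  other holds in every Hausdorff space.
\<close>

definition cell_structure ::
  "'a topology \<Rightarrow> 'a set set \<Rightarrow> ('a set \<Rightarrow> nat) \<Rightarrow> ('a set \<Rightarrow> (nat \<Rightarrow> real) \<Rightarrow> 'a) \<Rightarrow> bool"
where
  "cell_structure X \<E> d \<Phi> \<longleftrightarrow>
     \<Union>\<E> = topspace X \<and> pairwise disjnt \<E> \<and>
     (\<forall>e\<in>\<E>. continuous_map (disc (d e)) X (\<Phi> e) \<and>
        homeomorphic_map (subtopology (disc (d e)) (open_disc (d e))) (subtopology X e) (\<Phi> e)) \<and>
     (\<forall>e\<in>\<E>. \<exists>\<F>. finite \<F> \<and> \<F> \<subseteq> {e'\<in>\<E>. d e' < d e} \<and> \<Phi> e ` disc_boundary (d e) \<subseteq> \<Union>\<F>) \<and>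
     (\<forall>A\<subseteq>topspace X.
        (\<forall>e\<in>\<E>. closedin X (A \<inter> \<Phi> e ` topspace (disc (d e)))) \<longrightarrow> closedin X A)"

definition CW_complex :: "'a topology \<Rightarrow> bool" where
  "CW_complex X \<longleftrightarrow> Hausdorff_space X \<and> (\<exists>\<E> d \<Phi>. cell_structure X \<E> d \<Phi>)"


section \<open>Homotopy groups, simple connectivity and \<open>p\<close>-local spaces\<close>

definition cube :: "nat \<Rightarrow> (nat \<Rightarrow> real) topology" where
  "cube n = subtopology (Euclidean_space n) {t. \<forall>i<n. 0 \<le> t i \<and> t i \<le> 1}"

definition cube_boundary :: "nat \<Rightarrow> (nat \<Rightarrow> real) set" where
  "cube_boundary n = {t \<in> topspace (cube n). \<exists>i<n. t i = 0 \<or> t i = 1}"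

definition spheroids :: "nat \<Rightarrow> 'a topology \<Rightarrow> 'a \<Rightarrow> ((nat \<Rightarrow> real) \<Rightarrow> 'a) set" where
  "spheroids n X x = {\<alpha>. continuous_map (cube n) X \<alpha> \<and> (\<forall>t\<in>cube_boundary n. \<alpha> t = x)}"

definition spheroid_homotopy ::
  "nat \<Rightarrow> 'a topology \<Rightarrow> 'a \<Rightarrow> (((nat \<Rightarrow> real) \<Rightarrow> 'a) \<times> ((nat \<Rightarrow> real) \<Rightarrow> 'a)) set" where
  "spheroid_homotopy n X x =
     {(\<alpha>, \<beta>). homotopic_with (\<lambda>\<gamma>. \<forall>t\<in>cube_boundary n. \<gamma> t = x) (cube n) X \<alpha> \<beta>}"

definition spheroid_concat ::
  "((nat \<Rightarrow> real) \<Rightarrow> 'a) \<Rightarrow> ((nat \<Rightarrow> real) \<Rightarrow> 'a) \<Rightarrow> (nat \<Rightarrow> real) \<Rightarrow> 'a" where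
  "spheroid_concat \<alpha> \<beta> =
     (\<lambda>t. if t 0 \<le> 1/2 then \<alpha> (t(0 := 2 * t 0)) else \<beta> (t(0 := 2 * t 0 - 1)))"

text \<open>This is the \<open>n\<close>-th homotopy group at the base point \<open>x\<close> for \<open>n \<ge> 1\<close> only.\<close>

definition homotopy_group ::
  "nat \<Rightarrow> 'a topology \<Rightarrow> 'a \<Rightarrow> ((nat \<Rightarrow> real) \<Rightarrow> 'a) set monoid" where
  "homotopy_group n X x =
     \<lparr>carrier = spheroids n X x // spheroid_homotopy n X x,
      monoid.mult = (\<lambda>A B. \<Union>\<alpha>\<in>A. \<Union>\<beta>\<in>B. spheroid_homotopy n X x `` {spheroid_concat \<alpha> \<beta>}),
      one = spheroid_homotopy n X x `` {\<lambda>t. x}\<rparr>"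

definition simply_connected_space :: "'a topology \<Rightarrow> bool" where
  "simply_connected_space X \<longleftrightarrow>
     path_connected_space X \<and> (\<forall>x\<in>topspace X. trivial_group (homotopy_group 1 X x))"

definition p_local_group :: "nat \<Rightarrow> ('g, 'm) monoid_scheme \<Rightarrow> bool" where
  "p_local_group p G \<longleftrightarrow>
     (\<forall>q::nat. prime q \<and> q \<noteq> p \<longrightarrow> bij_betw (\<lambda>x. x [^]\<^bsub>G\<^esub> q) (carrier G) (carrier G))"

text \<open>This is the standard notion for simply connected (more generally, nilpotent) spaces.\<close>

definition p_local_space :: "nat \<Rightarrow> 'a topology \<Rightarrow> bool" where
  "p_local_space p X \<longleftrightarrow>
     (\<forall>x\<in>topspace X. \<forall>n\<ge>1. p_local_group p (homotopy_group n X x))"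


section \<open>Finite generation over the localized integers\<close>

definition localized_integers :: "nat \<Rightarrow> rat ring" where
  "localized_integers p =
     \<lparr>carrier = {of_int a / of_int b | a b. \<not> int p dvd b},
      monoid.mult = (*), one = 1, ring.zero = 0, add = (+)\<rparr>"

text \<open>
  The homology groups of the library are written multiplicatively, modules additively.
  The multiplication and unit of a module record play no role.
\<close>

definition module_of_group ::
  "('g, 'm) monoid_scheme \<Rightarrow> ('r \<Rightarrow> 'g \<Rightarrow> 'g) \<Rightarrow> ('r, 'g) module" where
  "module_of_group G s =
     \<lparr>carrier = carrier G, monoid.mult = monoid.mult G, one = \<one>\<^bsub>G\<^esub>,
      ring.zero = \<one>\<^bsub>G\<^esub>, add = monoid.mult G, smult = s\<rparr>"

definition finitely_generated_module ::
  "('r, 'k) ring_scheme \<Rightarrow> ('r, 'g, 'm) module_scheme \<Rightarrow> bool" where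
  "finitely_generated_module R M \<longleftrightarrow>
     module R M \<and>
     (\<exists>S. finite S \<and> S \<subseteq> carrier M \<and> (\<forall>N. submodule N R M \<and> S \<subseteq> N \<longrightarrow> N = carrier M))"

text \<open>An abelian group has at most one module structure over the localized integers.\<close>

definition fin_gen_over_localized_integers :: "nat \<Rightarrow> ('g, 'm) monoid_scheme \<Rightarrow> bool" where
  "fin_gen_over_localized_integers p G \<longleftrightarrow>
     (\<exists>s. finitely_generated_module (localized_integers p) (module_of_group G s))"


section \<open>Reduced singular homology and cohomology with coefficients\<close>

text \<open>
  The coefficient group \<open>G\<close> is an abelian group in multiplicative notation. Chains are finitely
  supported functions from singular simplices to \<open>G\<close>, cochains are arbitrary such functions.
\<close>

definition coeff_chain_group ::
  "'g monoid \<Rightarrow> nat \<Rightarrow> 'a topology \<Rightarrow> (((nat \<Rightarrow> real) \<Rightarrow> 'a) \<Rightarrow> 'g) monoid" where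
  "coeff_chain_group G n X = sum_group (singular_simplex_set n X) (\<lambda>_. G)"

definition coeff_cochain_group ::
  "'g monoid \<Rightarrow> nat \<Rightarrow> 'a topology \<Rightarrow> (((nat \<Rightarrow> real) \<Rightarrow> 'a) \<Rightarrow> 'g) monoid" where
  "coeff_cochain_group G n X = product_group (singular_simplex_set n X) (\<lambda>_. G)"

definition coeff_support ::
  "'g monoid \<Rightarrow> nat \<Rightarrow> 'a topology \<Rightarrow> (((nat \<Rightarrow> real) \<Rightarrow> 'a) \<Rightarrow> 'g) \<Rightarrow> ((nat \<Rightarrow> real) \<Rightarrow> 'a) set"
where
  "coeff_support G n X c = {\<sigma> \<in> singular_simplex_set n X. c \<sigma> \<noteq> \<one>\<^bsub>G\<^esub>}"

text \<open>
  The boundary \<open>C\<^sub>n \<rightarrow> C\<^bsub>n-1\<^esub>\<close> for \<open>n \<ge> 1\<close>, sending \<open>\<Sum>\<^sub>\<sigma> c\<^sub>\<sigma> \<sigma>\<close> to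
  \<open>\<Sum>\<^sub>\<sigma> \<Sum>\<^sub>k (-1)\<^sup>k c\<^sub>\<sigma> \<partial>\<^sub>k\<sigma>\<close>, written out coefficient by coefficient.
\<close>

definition coeff_boundary ::
  "'g monoid \<Rightarrow> nat \<Rightarrow> 'a topology \<Rightarrow>
     (((nat \<Rightarrow> real) \<Rightarrow> 'a) \<Rightarrow> 'g) \<Rightarrow> ((nat \<Rightarrow> real) \<Rightarrow> 'a) \<Rightarrow> 'g" where
  "coeff_boundary G n X c =
     (\<lambda>\<tau>\<in>singular_simplex_set (n - 1) X.
        finprod G (\<lambda>(\<sigma>, k). c \<sigma> [^]\<^bsub>G\<^esub> ((-1) ^ k :: int))
          {(\<sigma>, k). \<sigma> \<in> coeff_support G n X c \<and> k \<le> n \<and> singular_face n k \<sigma> = \<tau>})"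

definition coeff_augmentation ::
  "'g monoid \<Rightarrow> 'a topology \<Rightarrow> (((nat \<Rightarrow> real) \<Rightarrow> 'a) \<Rightarrow> 'g) \<Rightarrow> 'g" where
  "coeff_augmentation G X c = finprod G c (coeff_support G 0 X c)"

definition coeff_coboundary ::
  "'g monoid \<Rightarrow> nat \<Rightarrow> 'a topology \<Rightarrow>
     (((nat \<Rightarrow> real) \<Rightarrow> 'a) \<Rightarrow> 'g) \<Rightarrow> ((nat \<Rightarrow> real) \<Rightarrow> 'a) \<Rightarrow> 'g" where
  "coeff_coboundary G n X \<phi> =
     (\<lambda>\<sigma>\<in>singular_simplex_set (Suc n) X.
        finprod G (\<lambda>k. \<phi> (singular_face (Suc n) k \<sigma>) [^]\<^bsub>G\<^esub> ((-1) ^ k :: int)) {..Suc n})"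

definition coeff_coaugmentation ::
  "'a topology \<Rightarrow> 'g \<Rightarrow> ((nat \<Rightarrow> real) \<Rightarrow> 'a) \<Rightarrow> 'g" where
  "coeff_coaugmentation X g = (\<lambda>\<sigma>\<in>singular_simplex_set 0 X. g)"

definition coeff_reduced_cycles ::
  "'g monoid \<Rightarrow> nat \<Rightarrow> 'a topology \<Rightarrow> (((nat \<Rightarrow> real) \<Rightarrow> 'a) \<Rightarrow> 'g) set" where
  "coeff_reduced_cycles G n X =
     (if n = 0 then kernel (coeff_chain_group G 0 X) G (coeff_augmentation G X)
      else kernel (coeff_chain_group G n X) (coeff_chain_group G (n - 1) X) (coeff_boundary G n X))"

definition coeff_boundaries ::
  "'g monoid \<Rightarrow> nat \<Rightarrow> 'a topology \<Rightarrow> (((nat \<Rightarrow> real) \<Rightarrow> 'a) \<Rightarrow> 'g) set" where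
  "coeff_boundaries G n X =
     coeff_boundary G (Suc n) X ` carrier (coeff_chain_group G (Suc n) X)"

definition coeff_reduced_homology ::
  "'g monoid \<Rightarrow> nat \<Rightarrow> 'a topology \<Rightarrow> (((nat \<Rightarrow> real) \<Rightarrow> 'a) \<Rightarrow> 'g) set monoid" where
  "coeff_reduced_homology G n X =
     subgroup_generated (coeff_chain_group G n X) (coeff_reduced_cycles G n X)
       Mod coeff_boundaries G n X"

definition coeff_cocycles ::
  "'g monoid \<Rightarrow> nat \<Rightarrow> 'a topology \<Rightarrow> (((nat \<Rightarrow> real) \<Rightarrow> 'a) \<Rightarrow> 'g) set" where
  "coeff_cocycles G n X =
     kernel (coeff_cochain_group G n X) (coeff_cochain_group G (Suc n) X) (coeff_coboundary G n X)"

definition coeff_reduced_coboundaries ::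
  "'g monoid \<Rightarrow> nat \<Rightarrow> 'a topology \<Rightarrow> (((nat \<Rightarrow> real) \<Rightarrow> 'a) \<Rightarrow> 'g) set" where
  "coeff_reduced_coboundaries G n X =
     (if n = 0 then coeff_coaugmentation X ` carrier G
      else coeff_coboundary G (n - 1) X ` carrier (coeff_cochain_group G (n - 1) X))"

definition coeff_reduced_cohomology ::
  "'g monoid \<Rightarrow> nat \<Rightarrow> 'a topology \<Rightarrow> (((nat \<Rightarrow> real) \<Rightarrow> 'a) \<Rightarrow> 'g) set monoid" where
  "coeff_reduced_cohomology G n X =
     subgroup_generated (coeff_cochain_group G n X) (coeff_cocycles G n X)
       Mod coeff_reduced_coboundaries G n X"

definition coeff_chain_map ::
  "'g monoid \<Rightarrow> nat \<Rightarrow> 'a topology \<Rightarrow> 'b topology \<Rightarrow> ('a \<Rightarrow> 'b) \<Rightarrow>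
     (((nat \<Rightarrow> real) \<Rightarrow> 'a) \<Rightarrow> 'g) \<Rightarrow> ((nat \<Rightarrow> real) \<Rightarrow> 'b) \<Rightarrow> 'g" where
  "coeff_chain_map G n X Y f c =
     (\<lambda>\<tau>\<in>singular_simplex_set n Y.
        finprod G c {\<sigma> \<in> coeff_support G n X c. simplex_map n f \<sigma> = \<tau>})"

definition coeff_cochain_map ::
  "nat \<Rightarrow> 'a topology \<Rightarrow> ('a \<Rightarrow> 'b) \<Rightarrow>
     (((nat \<Rightarrow> real) \<Rightarrow> 'b) \<Rightarrow> 'g) \<Rightarrow> ((nat \<Rightarrow> real) \<Rightarrow> 'a) \<Rightarrow> 'g" where
  "coeff_cochain_map n X f \<phi> = (\<lambda>\<sigma>\<in>singular_simplex_set n X. \<phi> (simplex_map n f \<sigma>))"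

text \<open>
  A (co)homology class is a coset \<open>A\<close> of the (co)boundaries; its image under the induced map is
  the coset containing the image of \<open>A\<close> under the (co)chain map.
\<close>

definition homology_induced ::
  "'g monoid \<Rightarrow> nat \<Rightarrow> 'a topology \<Rightarrow> 'b topology \<Rightarrow> ('a \<Rightarrow> 'b) \<Rightarrow>
     (((nat \<Rightarrow> real) \<Rightarrow> 'a) \<Rightarrow> 'g) set \<Rightarrow> (((nat \<Rightarrow> real) \<Rightarrow> 'b) \<Rightarrow> 'g) set" where
  "homology_induced G n X Y f A =
     coeff_boundaries G n Y <#>\<^bsub>coeff_chain_group G n Y\<^esub> (coeff_chain_map G n X Y f ` A)"

definition cohomology_induced ::
  "'g monoid \<Rightarrow> nat \<Rightarrow> 'a topology \<Rightarrow> ('a \<Rightarrow> 'b) \<Rightarrow>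
     (((nat \<Rightarrow> real) \<Rightarrow> 'b) \<Rightarrow> 'g) set \<Rightarrow> (((nat \<Rightarrow> real) \<Rightarrow> 'a) \<Rightarrow> 'g) set" where
  "cohomology_induced G n X f A =
     coeff_reduced_coboundaries G n X
       <#>\<^bsub>coeff_cochain_group G n X\<^esub> (coeff_cochain_map n X f ` A)"


section \<open>Based homotopy classes of self-maps and self-closeness numbers\<close>

definition based_homotopy :: "'a topology \<Rightarrow> 'a \<Rightarrow> (('a \<Rightarrow> 'a) \<times> ('a \<Rightarrow> 'a)) set" where
  "based_homotopy X x\<^sub>0 = {(f, g). homotopic_with (\<lambda>h. h x\<^sub>0 = x\<^sub>0) X X f g}"

text \<open>The monoid \<open>[X, X]\<close> under composition.\<close>

definition self_map_classes :: "'a topology \<Rightarrow> 'a \<Rightarrow> ('a \<Rightarrow> 'a) set monoid" where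
  "self_map_classes X x\<^sub>0 =
     \<lparr>carrier = {f. continuous_map X X f \<and> f x\<^sub>0 = x\<^sub>0} // based_homotopy X x\<^sub>0,
      monoid.mult = (\<lambda>A B. \<Union>f\<in>A. \<Union>g\<in>B. based_homotopy X x\<^sub>0 `` {f \<circ> g}),
      one = based_homotopy X x\<^sub>0 `` {id}\<rparr>"

definition self_equivalences :: "'a topology \<Rightarrow> 'a \<Rightarrow> ('a \<Rightarrow> 'a) set set" where
  "self_equivalences X x\<^sub>0 = Units (self_map_classes X x\<^sub>0)"

text \<open>
  Since homotopic maps induce the same map in (co)homology, the conditions below hold for all
  representatives of a class as soon as they hold for one.
\<close>

definition cohomology_iso_classes ::
  "nat \<Rightarrow> nat \<Rightarrow> 'a topology \<Rightarrow> 'a \<Rightarrow> ('a \<Rightarrow> 'a) set set" where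
  "cohomology_iso_classes p k X x\<^sub>0 =
     {A \<in> carrier (self_map_classes X x\<^sub>0). \<forall>f\<in>A. \<forall>i\<le>k.
        cohomology_induced (integer_mod_group p) i X f
          \<in> iso (coeff_reduced_cohomology (integer_mod_group p) i X)
                (coeff_reduced_cohomology (integer_mod_group p) i X)}"

definition homology_iso_classes ::
  "nat \<Rightarrow> nat \<Rightarrow> 'a topology \<Rightarrow> 'a \<Rightarrow> ('a \<Rightarrow> 'a) set set" where
  "homology_iso_classes p k X x\<^sub>0 =
     {A \<in> carrier (self_map_classes X x\<^sub>0). \<forall>f\<in>A. \<forall>i\<le>k.
        homology_induced (integer_mod_group p) i X X f
          \<in> iso (coeff_reduced_homology (integer_mod_group p) i X)
                (coeff_reduced_homology (integer_mod_group p) i X)}"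

definition cohomology_self_closeness :: "nat \<Rightarrow> 'a topology \<Rightarrow> 'a \<Rightarrow> enat" where
  "cohomology_self_closeness p X x\<^sub>0 =
     (if \<exists>k. cohomology_iso_classes p k X x\<^sub>0 = self_equivalences X x\<^sub>0
      then enat (LEAST k. cohomology_iso_classes p k X x\<^sub>0 = self_equivalences X x\<^sub>0) else \<infinity>)"

definition homology_self_closeness :: "nat \<Rightarrow> 'a topology \<Rightarrow> 'a \<Rightarrow> enat" where
  "homology_self_closeness p X x\<^sub>0 =
     (if \<exists>k. homology_iso_classes p k X x\<^sub>0 = self_equivalences X x\<^sub>0
      then enat (LEAST k. homology_iso_classes p k X x\<^sub>0 = self_equivalences X x\<^sub>0) else \<infinity>)"

end

theory Submission
  imports Defs
begin

text \<open>
  Over the field \<open>\<int>/p\<close>, reduced cohomology is the linear dual of reduced homology, degree by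
  degree and naturally in the space, and a linear map is bijective if and only if its dual is.
  Hence \<open>f\<^sup>*\<close> is an isomorphism in degree \<open>i\<close> if and only if \<open>f\<^sub>*\<close> is, the two families of
  classes agree for every \<open>k\<close>, and so do the self-closeness numbers. The duality is expressed
  through the evaluation pairing: (co)cycles and (co)boundaries are annihilators of each other.
\<close>

section \<open>Functionals on groups of prime exponent\<close>

text \<open>Chain groups are infinite-dimensional in general, so a space cannot be identified with
  its double dual: every functional on chains is evaluation of a cochain, but a functional on
  cochains need not come from a chain. Functionals are therefore constructed on the chain side only.
  All of them come from one fact: in an abelian group of prime exponent p, an element outside a
  subgroup is separated from it by a homomorphism to Z/p. Here primality is decisive, since nonzero
  residues can be inverted; the consequence that functionals extend is what removes the Ext term of
  the universal coefficient theorem. Two annihilator relations are formal: cycles are what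
  coboundaries kill, and cocycles are the cochains that kill boundaries. That a cochain killing all
  cycles is a coboundary is the relation that needs an extension of functionals. Identities between
  chains are tested by pairing with cochains, because coboundary and pullback have pointwise
  formulas while boundary and chain map collect coefficients over fibres.\<close>

lemma hom_integer_mod_group_int_pow:
  assumes "group G" "\<phi> \<in> hom G (integer_mod_group p)" "x \<in> carrier G"
  shows "\<phi> (x [^]\<^bsub>G\<^esub> (k::int)) = (k * \<phi> x) mod int p"
  using group_hom.hom_int_pow[of G "integer_mod_group p" \<phi> x k] assms
  by (simp add: group_hom_def group_hom_axioms_def int_pow_integer_mod_group)

lemma hom_integer_mod_group_range:
  assumes "\<phi> \<in> hom G (integer_mod_group p)" "x \<in> carrier G" "p > 0"
  shows "0 \<le> \<phi> x" "\<phi> x < int p"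
  using assms by (auto simp: hom_def Pi_iff carrier_integer_mod_group)

lemma exists_int_inverse_mod_prime:
  assumes "prime p" "\<not> int p dvd j"
  obtains a b where "a * j + b * int p = 1"
proof -
  have "coprime (int p) j"
    using assms by (simp add: prime_imp_coprime)
  then have "gcd j (int p) = 1"
    by (simp add: coprime_iff_gcd_eq_1 gcd.commute)
  then show thesis
    using that bezout_int[of j "int p"] by auto
qed

text \<open>This is a vector space over Z/p in multiplicative notation. Scalars act by powers, so
  subgroups are the subspaces and homomorphisms to \<open>integer_mod_group p\<close> are the linear
  functionals.\<close>

locale exponent_group = comm_group G for G (structure) and p :: nat +
  assumes prime: "prime p" and exponent: "x \<in> carrier G \<Longrightarrow> x [^] p = \<one>"
begin

lemma p_pos: "p > 0"
  using prime by (rule prime_gt_0_nat)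

lemma int_pow_exponent:
  assumes "x \<in> carrier G"
  shows "x [^] (int p * k) = \<one>"
proof -
  have "x [^] (int p) = \<one>"
    using exponent[OF assms] by (simp add: int_pow_int)
  then show ?thesis
    using assms int_pow_pow[of x "int p" k] by (simp add: mult.commute)
qed

lemma int_pow_mod_exponent:
  assumes "x \<in> carrier G"
  shows "x [^] (k mod int p) = x [^] k"
proof -
  have "x [^] k = x [^] (int p * (k div int p) + k mod int p)"
    by simp
  also have "\<dots> = x [^] (k mod int p)"
    using assms by (simp only: int_pow_mult int_pow_exponent l_one int_pow_closed)
  finally show ?thesis
    by simp
qed

section \<open>Maximal subgroups and separation of points by functionals\<close>

lemma subgroup_adjoin:
  assumes "subgroup M G" "x \<in> carrier G"
  shows "subgroup {m \<otimes> x [^] j | m (j::int). m \<in> M} G" (is "subgroup ?N G")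
proof (rule subgroupI)
  note M = subgroup.mem_carrier[OF assms(1)]
  show "?N \<subseteq> carrier G"
    using M assms by auto
  show "?N \<noteq> {}"
    using subgroup.one_closed[OF assms(1)] by auto
  fix a assume "a \<in> ?N"
  then obtain m j where a: "a = m \<otimes> x [^] (j::int)" "m \<in> M" by auto
  have "inv a = inv m \<otimes> x [^] (-j)"
    using a M assms(2) by (simp add: inv_mult int_pow_neg)
  then show "inv a \<in> ?N"
    using a subgroup.m_inv_closed[OF assms(1)] by blast
  fix b assume "b \<in> ?N"
  then obtain m' j' where b: "b = m' \<otimes> x [^] (j'::int)" "m' \<in> M" by auto
  have "a \<otimes> b = (m \<otimes> m') \<otimes> x [^] (j + j')"
    using a b M assms(2) by (simp add: int_pow_mult m_ac)
  then show "a \<otimes> b \<in> ?N"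
    using a b subgroup.m_closed[OF assms(1)] by blast
qed

text \<open>Zorn's lemma takes the place of a choice of basis, in arbitrary dimension. The result is
  a hyperplane that contains \<open>W\<close> and misses \<open>v\<close>.\<close>

lemma exists_maximal_subgroup_avoiding:
  assumes "subgroup W G" "v \<notin> W"
  obtains M where "subgroup M G" "W \<subseteq> M" "v \<notin> M"
    "\<And>N. subgroup N G \<Longrightarrow> M \<subseteq> N \<Longrightarrow> v \<notin> N \<Longrightarrow> N = M"
proof -
  define \<A> where "\<A> = {M. subgroup M G \<and> W \<subseteq> M \<and> v \<notin> M}"
  have "\<exists>M\<in>\<A>. \<forall>N\<in>\<A>. M \<subseteq> N \<longrightarrow> N = M"
  proof (rule subset_Zorn_nonempty)
    show "\<A> \<noteq> {}"
      using assms by (auto simp: \<A>_def)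
    fix \<C> assume \<C>: "\<C> \<noteq> {}" "subset.chain \<A> \<C>"
    then have sub: "\<And>M. M \<in> \<C> \<Longrightarrow> subgroup M G \<and> W \<subseteq> M \<and> v \<notin> M"
      and lin: "\<And>M N. M \<in> \<C> \<Longrightarrow> N \<in> \<C> \<Longrightarrow> M \<subseteq> N \<or> N \<subseteq> M"
      unfolding \<A>_def subset_chain_def by blast+
    have "subgroup (\<Union>\<C>) G"
    proof (rule subgroupI)
      show "\<Union>\<C> \<subseteq> carrier G"
        using sub subgroup.subset by blast
      obtain M where "M \<in> \<C>"
        using \<C>(1) by blast
      then have "\<one> \<in> M"
        using sub subgroup.one_closed by blast
      then show "\<Union>\<C> \<noteq> {}"
        using \<open>M \<in> \<C>\<close> by blast
    next
      fix a assume "a \<in> \<Union>\<C>"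
      then obtain M where M: "M \<in> \<C>" "a \<in> M"
        by blast
      then have sM: "subgroup M G"
        using sub by blast
      from subgroup.m_inv_closed[OF sM M(2)] show "inv a \<in> \<Union>\<C>"
        using M(1) by (rule UnionI[rotated])
      fix b assume "b \<in> \<Union>\<C>"
      then obtain N where N: "N \<in> \<C>" "b \<in> N"
        by blast
      then have sN: "subgroup N G"
        using sub by blast
      from lin[OF M(1) N(1)] show "a \<otimes> b \<in> \<Union>\<C>"
      proof
        assume "M \<subseteq> N"
        then show ?thesis
          using M N subgroup.m_closed[OF sN] by (intro UnionI[of N]) auto
      next
        assume "N \<subseteq> M"
        then show ?thesis
          using M N subgroup.m_closed[OF sM] by (intro UnionI[of M]) auto
      qed
    qed
    then show "\<Union>\<C> \<in> \<A>"
      using \<C>(1) sub by (auto simp: \<A>_def)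
  qed
  then show thesis
    using that by (auto simp: \<A>_def)
qed

text \<open>If \<open>x\<close> is not in \<open>M\<close>, adjoining it must by maximality bring in
  \<open>v\<close>, say v = m x^j. Here j is prime to p, since otherwise x^j = 1 and v = m would lie
  in \<open>M\<close>. Hence the equation can be solved for \<open>x\<close> modulo
  \<open>M\<close>.\<close>

lemma maximal_subgroup_complement:
  assumes M: "subgroup M G" and v: "v \<in> carrier G" "v \<notin> M"
    and max: "\<And>N. subgroup N G \<Longrightarrow> M \<subseteq> N \<Longrightarrow> v \<notin> N \<Longrightarrow> N = M"
    and x: "x \<in> carrier G"
  shows "\<exists>k. 0 \<le> k \<and> k < int p \<and> x \<otimes> inv (v [^] k) \<in> M"
proof -
  have Mc: "\<And>m. m \<in> M \<Longrightarrow> m \<in> carrier G"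
    using M subgroup.subset by blast
  show ?thesis
  proof (cases "x \<in> M")
    case True
    then show ?thesis
      using p_pos x by (intro exI[of _ 0]) auto
  next
    case False
    let ?N = "{m \<otimes> x [^] j | m (j::int). m \<in> M}"
    have "M \<subseteq> ?N"
    proof
      fix m assume "m \<in> M"
      then have "m = m \<otimes> x [^] (0::int)" using Mc by simp
      then show "m \<in> ?N" using \<open>m \<in> M\<close> by blast
    qed
    moreover have "x \<in> ?N"
    proof -
      have "x = \<one> \<otimes> x [^] (1::int)" using x by simp
      then show ?thesis using subgroup.one_closed[OF M] by blast
    qed
    ultimately have "v \<in> ?N"
      using max[OF subgroup_adjoin[OF M x]] False by blast
    then obtain m j where mj: "m \<in> M" "v = m \<otimes> x [^] (j::int)"
      by blast
    have "\<not> int p dvd j"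
    proof
      assume "int p dvd j"
      then have "v = m"
        using mj Mc int_pow_exponent[OF x] by (auto elim!: dvdE)
      then show False using mj v by simp
    qed
    then obtain a b where ab: "a * j + b * int p = 1"
      using exists_int_inverse_mod_prime[OF prime] by blast
    then have "j * a = 1 + int p * (- b)"
      by (simp add: algebra_simps)
    then have "x [^] (j * a) = x [^] (1 + int p * (- b))"
      by (rule arg_cong)
    also have "\<dots> = x"
      using x by (simp only: int_pow_mult int_pow_exponent) simp
    \<comment> \<open>The exponent \<open>a\<close> inverts \<open>j\<close> modulo
      \<open>p\<close>, so raising v = m x^j to the power \<open>a\<close> turns the second factor
      into \<open>x\<close>.\<close>
    finally have "v [^] a = m [^] a \<otimes> x"
      using mj x Mc by (simp add: int_pow_distrib int_pow_pow)
    moreover have "m [^] a \<in> carrier G"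
      using mj(1) Mc by simp
    ultimately have "x \<otimes> inv (v [^] a) = inv (m [^] a)"
      using x by (simp add: inv_mult_group flip: m_assoc)
    then have "x \<otimes> inv (v [^] (a mod int p)) \<in> M"
      using int_pow_mod_exponent[OF v(1)] mj(1) M
      by (simp add: subgroup.m_inv_closed subgroup_int_pow_closed)
    then show ?thesis
      using p_pos by (intro exI[of _ "a mod int p"]) auto
  qed
qed

text \<open>A maximal subgroup among those that contain \<open>W\<close> and avoid \<open>v\<close> has the powers of \<open>v\<close> as
  complement, so the exponent of \<open>v\<close> is the desired functional.\<close>

lemma exists_separating_functional:
  assumes W: "subgroup W G" and v: "v \<in> carrier G" "v \<notin> W"
  obtains \<psi> where "\<psi> \<in> hom G (integer_mod_group p)" "\<And>w. w \<in> W \<Longrightarrow> \<psi> w = 0" "\<psi> v = 1"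
proof -
  obtain M where M: "subgroup M G" "W \<subseteq> M" "v \<notin> M"
    and max: "\<And>N. subgroup N G \<Longrightarrow> M \<subseteq> N \<Longrightarrow> v \<notin> N \<Longrightarrow> N = M"
    using exists_maximal_subgroup_avoiding[OF assms(1,3)] by blast
  note Mc = subgroup.mem_carrier[OF M(1)]
  \<comment> \<open>If \<open>k\<close> were prime to \<open>p\<close>, then \<open>v\<close> would
    be a power of v^k and so lie in \<open>M\<close>. Thus \<open>M\<close> meets the powers of
    \<open>v\<close> trivially.\<close>
  have pow_notin: "int p dvd k" if "v [^] k \<in> M" for k :: int
  proof (rule ccontr)
    assume "\<not> int p dvd k"
    then obtain a b where ab: "a * k + b * int p = 1"
      using exists_int_inverse_mod_prime[OF prime] by blast
    have "v = v [^] (k * a + int p * b)"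
      using ab v by (simp add: algebra_simps)
    also have "\<dots> = (v [^] k) [^] a"
      using v by (simp only: int_pow_mult int_pow_exponent int_pow_pow) simp
    finally show False
      using subgroup_int_pow_closed[OF M(1) that, of a] M(3) by simp
  qed
  have uniq: "k = l" if "0 \<le> k" "k < int p" "x \<otimes> inv (v [^] k) \<in> M"
      "0 \<le> l" "l < int p" "x \<otimes> inv (v [^] l) \<in> M" "x \<in> carrier G" for k l x
  proof -
    \<comment> \<open>Dividing the two memberships cancels \<open>x\<close> and leaves v^(k-l), to
      which \<open>pow_notin\<close> applies.\<close>
    have "inv (x \<otimes> inv (v [^] k)) \<otimes> (x \<otimes> inv (v [^] l)) \<in> M"
      using that M(1) by (simp add: subgroup.m_closed subgroup.m_inv_closed)
    also have "inv (x \<otimes> inv (v [^] k)) \<otimes> (x \<otimes> inv (v [^] l))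
        = (inv x \<otimes> x) \<otimes> (v [^] k \<otimes> inv (v [^] l))"
      using that(7) v by (simp only: inv_mult inv_inv inv_closed int_pow_closed m_closed m_ac)
    also have "\<dots> = v [^] (k - l)"
      using that(7) v by (simp add: int_pow_diff)
    finally have "int p dvd k - l"
      by (rule pow_notin)
    then have "k mod int p = l mod int p"
      by (simp add: mod_eq_dvd_iff)
    then show ?thesis
      using that by simp
  qed
  define \<psi> where "\<psi> x = (SOME k. 0 \<le> k \<and> k < int p \<and> x \<otimes> inv (v [^] k) \<in> M)" for x
  have \<psi>: "0 \<le> \<psi> x" "\<psi> x < int p" "x \<otimes> inv (v [^] \<psi> x) \<in> M" if "x \<in> carrier G" for x
    using someI_ex[OF maximal_subgroup_complement[OF M(1) v(1) M(3) max that]]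
    unfolding \<psi>_def by auto
  have eq: "\<psi> x = k" if "0 \<le> k" "k < int p" "x \<otimes> inv (v [^] k) \<in> M" "x \<in> carrier G" for x k
    using uniq[OF \<psi>[OF that(4)] that] .
  show thesis
  proof
    show "\<psi> \<in> hom G (integer_mod_group p)"
    proof (rule homI)
      show "\<psi> x \<in> carrier (integer_mod_group p)" if "x \<in> carrier G" for x
        using \<psi>[OF that] p_pos by (simp add: carrier_integer_mod_group)
      fix x y assume xy: "x \<in> carrier G" "y \<in> carrier G"
      \<comment> \<open>By uniqueness of the exponent it suffices that the sum, reduced into the
        admissible range, moves the product into \<open>M\<close>.\<close>
      have "(x \<otimes> y) \<otimes> inv (v [^] ((\<psi> x + \<psi> y) mod int p))
          = (x \<otimes> y) \<otimes> inv (v [^] \<psi> x \<otimes> v [^] \<psi> y)"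
        using v by (simp add: int_pow_mod_exponent int_pow_mult)
      also have "\<dots> = (x \<otimes> inv (v [^] \<psi> x)) \<otimes> (y \<otimes> inv (v [^] \<psi> y))"
        using xy v by (simp add: inv_mult m_ac)
      also have "\<dots> \<in> M"
        using \<psi>(3) xy M(1) by (simp add: subgroup.m_closed)
      finally show "\<psi> (x \<otimes> y) = \<psi> x \<otimes>\<^bsub>integer_mod_group p\<^esub> \<psi> y"
        using xy p_pos by (subst eq) auto
    qed
    show "\<psi> w = 0" if "w \<in> W" for w
      using that M(2) Mc p_pos by (intro eq) auto
    show "\<psi> v = 1"
      using v prime_gt_1_nat[OF prime] subgroup.one_closed[OF M(1)] by (intro eq) auto
  qed
qed

text \<open>This is the injectivity of Z/p among groups of exponent p: \<open>ker\<close> says that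
  \<open>\<phi>\<close> descends to the image of \<open>A\<close> in G/B, and \<open>\<psi>\<close>
  extends it to all of G/B. Modulo the kernel \<open>K\<close> of \<open>\<phi>\<close>, the group
  \<open>A\<close> is generated by one element \<open>a1\<close> with \<open>\<phi> a1 = 1\<close>,
  so a functional that vanishes on \<open>B\<close> and \<open>h(K)\<close> and is 1 at
  \<open>h a1\<close> is already right everywhere.\<close>

lemma functional_factors_through:
  assumes A: "group A" and h: "h \<in> hom A G" and \<phi>: "\<phi> \<in> hom A (integer_mod_group p)"
    and B: "subgroup B G" and ker: "\<And>a. a \<in> carrier A \<Longrightarrow> h a \<in> B \<Longrightarrow> \<phi> a = 0"
  obtains \<psi> where "\<psi> \<in> hom G (integer_mod_group p)" "\<And>b. b \<in> B \<Longrightarrow> \<psi> b = 0"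
    "\<And>a. a \<in> carrier A \<Longrightarrow> \<psi> (h a) = \<phi> a"
\<comment> \<open>The zero functional is set apart because it admits no element of value 1 for the
  normalisation below.\<close>
proof (cases "\<forall>a\<in>carrier A. \<phi> a = 0")
  case True
  have "(\<lambda>_. 0) \<in> hom G (integer_mod_group p)"
    using p_pos by (auto simp: hom_def carrier_integer_mod_group)
  then show thesis
    using that True by fastforce
next
  case False
  interpret A: group A by fact
  interpret h: group_hom A G h
    using h by unfold_locales
  interpret \<phi>: group_hom A "integer_mod_group p" \<phi>
    using \<phi> by (simp add: group_hom_def group_hom_axioms_def A)
  from False obtain a0 where a0: "a0 \<in> carrier A" "\<phi> a0 \<noteq> 0" by blast
  have "\<not> int p dvd \<phi> a0"
    using a0 hom_integer_mod_group_range[OF \<phi> a0(1) p_pos] by (auto dest: zdvd_imp_le)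
  then obtain s t where st: "s * \<phi> a0 + t * int p = 1"
    using exists_int_inverse_mod_prime[OF prime] by blast
  define a1 where "a1 = a0 [^]\<^bsub>A\<^esub> s"
  have a1: "a1 \<in> carrier A"
    using a0 by (simp add: a1_def)
  have "\<phi> a1 = (s * \<phi> a0) mod int p"
    using a0 hom_integer_mod_group_int_pow[OF A \<phi>] by (simp add: a1_def)
  also have "\<dots> = (s * \<phi> a0 + t * int p) mod int p"
    by simp
  also have "\<dots> = 1"
    using st prime_gt_1_nat[OF prime] by simp
  finally have \<phi>a1: "\<phi> a1 = 1" .
  define K where "K = kernel A (integer_mod_group p) \<phi>"
  have "subgroup (h ` K) G"
    using h.subgroup_img_is_subgroup[OF \<phi>.subgroup_kernel] by (simp add: K_def)
  then have W: "subgroup (B <#> h ` K) G"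
    using mult_subgroups B by blast
  \<comment> \<open>Otherwise \<open>a1\<close> would differ from an element of \<open>K\<close> by
    something that \<open>h\<close> sends into \<open>B\<close>, and \<open>ker\<close> would give
    \<open>\<phi> a1 = 0\<close>.\<close>
  have "h a1 \<notin> B <#> h ` K"
  proof
    assume "h a1 \<in> B <#> h ` K"
    then obtain b a where ba: "b \<in> B" "a \<in> carrier A" "\<phi> a = 0" "h a1 = b \<otimes> h a"
      by (auto simp: set_mult_def K_def kernel_def)
    have "h (a1 \<otimes>\<^bsub>A\<^esub> inv\<^bsub>A\<^esub> a) = b"
      using ba a1 subgroup.mem_carrier[OF B] by (simp add: m_assoc)
    then have "\<phi> (a1 \<otimes>\<^bsub>A\<^esub> inv\<^bsub>A\<^esub> a) = 0"
      using ba a1 by (intro ker) auto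
    then show False
      using ba a1 \<phi>a1 prime_gt_1_nat[OF prime] by simp
  qed
  then obtain \<psi> where \<psi>: "\<psi> \<in> hom G (integer_mod_group p)"
      "\<And>w. w \<in> B <#> h ` K \<Longrightarrow> \<psi> w = 0" "\<psi> (h a1) = 1"
    using exists_separating_functional[OF W, of "h a1"] a1 by auto
  interpret \<psi>: group_hom G "integer_mod_group p" \<psi>
    using \<psi>(1) by (simp add: group_hom_def group_hom_axioms_def)
  have BW: "\<psi> b = 0" if "b \<in> B" for b
  proof (rule \<psi>(2))
    have "b = b \<otimes> h \<one>\<^bsub>A\<^esub>"
      using that subgroup.mem_carrier[OF B] by simp
    then show "b \<in> B <#> h ` K"
      using that A.one_closed by (force simp: set_mult_def K_def kernel_def)
  qed
  have KW: "\<psi> (h a) = 0" if "a \<in> K" for a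
  proof (rule \<psi>(2))
    have "h a = \<one> \<otimes> h a"
      using that by (simp add: K_def kernel_def)
    then show "h a \<in> B <#> h ` K"
      using that subgroup.one_closed[OF B] by (auto simp: set_mult_def)
  qed
  have "\<psi> (h a) = \<phi> a" if a: "a \<in> carrier A" for a
  proof -
    \<comment> \<open>This is the \<open>K\<close>-component of \<open>a\<close>, left after
      splitting off the power of \<open>a1\<close> on which \<open>\<phi>\<close> has the same
      value.\<close>
    define c where "c = a \<otimes>\<^bsub>A\<^esub> inv\<^bsub>A\<^esub> (a1 [^]\<^bsub>A\<^esub> \<phi> a)"
    note r = hom_integer_mod_group_range[OF \<phi> a p_pos]
    have pw: "\<phi> (a1 [^]\<^bsub>A\<^esub> \<phi> a) = \<phi> a"
      using hom_integer_mod_group_int_pow[OF A \<phi> a1] r \<phi>a1 by simp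
    have "\<phi> c = \<phi> a \<otimes>\<^bsub>integer_mod_group p\<^esub> inv\<^bsub>integer_mod_group p\<^esub> (\<phi> (a1 [^]\<^bsub>A\<^esub> \<phi> a))"
      using a a1 unfolding c_def by (simp only: \<phi>.hom_mult \<phi>.hom_inv A.inv_closed A.int_pow_closed)
    also have "\<dots> = 0"
      using a by (simp add: pw group.r_inv del: mult_integer_mod_group inv_integer_mod_group)
    finally have "c \<in> K"
      using a a1 by (simp add: K_def kernel_def c_def)
    then have "\<psi> (h c) = 0" by (rule KW)
    have "a = c \<otimes>\<^bsub>A\<^esub> a1 [^]\<^bsub>A\<^esub> \<phi> a"
      using a a1 by (simp add: c_def A.m_assoc)
    moreover have c: "c \<in> carrier A"
      using a a1 by (simp add: c_def)
    ultimately have "h a = h c \<otimes> h a1 [^] \<phi> a"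
      using a1 h.hom_mult[OF c A.int_pow_closed[OF a1, of "\<phi> a"]] h.hom_int_pow[OF a1, of "\<phi> a"] by simp
    then have "\<psi> (h a) = \<psi> (h c \<otimes> h a1 [^] \<phi> a)"
      by simp
    also have "\<dots> = (\<psi> (h c) + \<psi> (h a1 [^] \<phi> a)) mod int p"
      using c a1 by simp
    also have "\<dots> = \<phi> a"
      using hom_integer_mod_group_int_pow[OF is_group \<psi>(1), of "h a1" "\<phi> a"] a1 \<psi>(3) \<open>\<psi> (h c) = 0\<close> r
      by simp
    finally show ?thesis .
  qed
  then show thesis
    using that \<psi>(1) BW by blast
qed

end

section \<open>Induced maps on quotients\<close>

text \<open>The quotient consists of the cosets \<open>B #> z\<close> with \<open>z \<in> Z\<close>.
  Bijectivity is unwound to conditions on representatives, the form in which functionals can test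
  it: the first conjunct is a trivial kernel, the second surjectivity modulo
  \<open>B\<close>.\<close>

lemma (in comm_group) induced_quotient_iso_iff:
  assumes Z: "subgroup Z G" and B: "subgroup B G" and f: "f \<in> hom G G"
    and fZ: "f ` Z \<subseteq> Z" and fB: "f ` B \<subseteq> B"
  shows "(\<lambda>A. B <#> f ` A) \<in> iso (subgroup_generated G Z Mod B) (subgroup_generated G Z Mod B)
    \<longleftrightarrow> (\<forall>z\<in>Z. f z \<in> B \<longrightarrow> z \<in> B) \<and> (\<forall>z\<in>Z. \<exists>z'\<in>Z. z \<otimes> inv (f z') \<in> B)"
    (is "?F \<in> iso ?Q ?Q \<longleftrightarrow> ?inj \<and> ?surj")
proof -
  interpret f: group_hom G G f
    using f by unfold_locales
  note Zc = subgroup.mem_carrier[OF Z] and Bc = subgroup.mem_carrier[OF B]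
  have carrier: "carrier ?Q = (\<lambda>z. B #> z) ` Z"
    using subgroup.carrier_subgroup_generated_subgroup[OF Z]
    by (auto simp: FactGroup_def RCOSETS_def r_coset_def)
  have mult: "x \<otimes>\<^bsub>?Q\<^esub> y = x <#> y" for x y
    by (auto simp: set_mult_def)
  have eq: "B #> x = B #> y \<longleftrightarrow> x \<otimes> inv y \<in> B" if "x \<in> carrier G" "y \<in> carrier G" for x y
    using that B by (metis repr_independence rcos_self subgroup.rcos_module is_group)
  \<comment> \<open>The invariance of \<open>B\<close> keeps the image of a coset inside one coset,
    and the factor \<open>B\<close> fills it up to the whole coset.\<close>
  have F: "?F (B #> z) = B #> f z" if z: "z \<in> carrier G" for z
  proof (intro equalityI subsetI)
    fix x assume "x \<in> ?F (B #> z)"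
    then obtain b b' where "b \<in> B" "b' \<in> B" "x = b \<otimes> f (b' \<otimes> z)"
      by (auto simp: set_mult_def r_coset_def)
    then have "x = (b \<otimes> f b') \<otimes> f z" "b \<otimes> f b' \<in> B"
      using z Bc fB subgroup.m_closed[OF B] by (auto simp: m_assoc)
    then show "x \<in> B #> f z"
      by (auto simp: r_coset_def)
  next
    fix x assume "x \<in> B #> f z"
    then obtain b where "b \<in> B" "x = b \<otimes> f (\<one> \<otimes> z)"
      using z by (auto simp: r_coset_def)
    then show "x \<in> ?F (B #> z)"
      using subgroup.one_closed[OF B] by (auto simp: set_mult_def r_coset_def)
  qed
  interpret B: normal B G
    using subgroup_imp_normal[OF B] .
  have "?F \<in> hom ?Q ?Q"
  proof (rule homI)
    show "?F x \<in> carrier ?Q" if "x \<in> carrier ?Q" for x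
      using that F Zc fZ by (auto simp: carrier)
    show "?F (x \<otimes>\<^bsub>?Q\<^esub> y) = ?F x \<otimes>\<^bsub>?Q\<^esub> ?F y" if xy: "x \<in> carrier ?Q" "y \<in> carrier ?Q" for x y
    proof -
      obtain a b where ab: "a \<in> Z" "b \<in> Z" "x = B #> a" "y = B #> b"
        using xy unfolding carrier by blast
      then show ?thesis
        using Zc by (simp only: mult B.rcos_sum F f.hom_mult f.hom_closed m_closed)
    qed
  qed
  moreover have "inj_on ?F (carrier ?Q) \<longleftrightarrow> ?inj"
  proof
    assume inj: "inj_on ?F (carrier ?Q)"
    show ?inj
    proof (intro ballI impI)
      fix z assume z: "z \<in> Z" "f z \<in> B"
      then have "B #> f z = B #> f \<one>"
        using Zc eq[of "f z" "f \<one>"] by simp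
      then have "?F (B #> z) = ?F (B #> \<one>)"
        using z Zc by (simp only: F one_closed)
      moreover have "B #> z \<in> carrier ?Q" "B #> \<one> \<in> carrier ?Q"
        unfolding carrier using z subgroup.one_closed[OF Z] by blast+
      ultimately have "B #> z = B #> \<one>"
        using inj_onD[OF inj, of "B #> z" "B #> \<one>"] by blast
      then show "z \<in> B"
        using z Zc eq[of z \<one>] by simp
    qed
  next
    assume inj: ?inj
    show "inj_on ?F (carrier ?Q)"
    proof (rule inj_onI)
      fix x y assume xy: "x \<in> carrier ?Q" "y \<in> carrier ?Q" "?F x = ?F y"
      then obtain a b where ab: "a \<in> Z" "b \<in> Z" "x = B #> a" "y = B #> b"
        unfolding carrier by blast
      then have "B #> f a = B #> f b"
        using xy(3) Zc by (simp only: F)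
      then have "f (a \<otimes> inv b) \<in> B"
        using ab Zc eq[of "f a" "f b"] by simp
      then have "a \<otimes> inv b \<in> B"
        using inj ab subgroup.m_closed[OF Z] subgroup.m_inv_closed[OF Z] by blast
      then show "x = y"
        using ab Zc eq[of a b] by simp
    qed
  qed
  moreover have "?F ` carrier ?Q = carrier ?Q \<longleftrightarrow> ?surj"
  proof -
    have "?F ` carrier ?Q = (\<lambda>z. B #> f z) ` Z"
      unfolding carrier image_image using Zc F by (intro image_cong) auto
    also have "\<dots> = carrier ?Q \<longleftrightarrow> (\<forall>z\<in>Z. \<exists>z'\<in>Z. B #> z = B #> f z')"
      using fZ unfolding carrier by blast
    also have "\<dots> \<longleftrightarrow> ?surj"
      using eq Zc f.hom_closed by (intro ball_cong bex_cong refl) blast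
    finally show ?thesis .
  qed
  ultimately show ?thesis
    by (auto simp: iso_def bij_betw_def)
qed

section \<open>Dual quotients\<close>

text \<open>\<open>D\<close> models the full dual of \<open>C\<close>. The asymmetry is intended:
  \<open>pairing_represents\<close> yields every functional on \<open>C\<close>, whereas functionals
  on \<open>D\<close> may be more numerous than the elements of \<open>C\<close>.\<close>

locale perfect_pairing = C: exponent_group C p + D: comm_group D
  for C :: "('a, 'm) monoid_scheme" (structure) and p :: nat and D :: "('b, 'n) monoid_scheme" +
  fixes P :: "'b \<Rightarrow> 'a \<Rightarrow> int"
  assumes pairing_hom: "\<phi> \<in> carrier D \<Longrightarrow> P \<phi> \<in> hom C (integer_mod_group p)"
    and pairing_add: "\<phi> \<in> carrier D \<Longrightarrow> \<psi> \<in> carrier D \<Longrightarrow> c \<in> carrier C \<Longrightarrow>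
      P (\<phi> \<otimes>\<^bsub>D\<^esub> \<psi>) c = (P \<phi> c + P \<psi> c) mod int p"
    and pairing_represents: "h \<in> hom C (integer_mod_group p) \<Longrightarrow>
      \<exists>\<phi>\<in>carrier D. \<forall>c\<in>carrier C. P \<phi> c = h c"
begin

definition annihilator :: "'a set \<Rightarrow> 'b set" where
  "annihilator S = {\<phi> \<in> carrier D. \<forall>c\<in>S. P \<phi> c = 0}"

definition coannihilator :: "'b set \<Rightarrow> 'a set" where
  "coannihilator R = {c \<in> carrier C. \<forall>\<phi>\<in>R. P \<phi> c = 0}"

lemma group_hom_pairing:
  "\<phi> \<in> carrier D \<Longrightarrow> group_hom C (integer_mod_group p) (P \<phi>)"
  using pairing_hom by (simp add: group_hom_def group_hom_axioms_def)

lemma group_hom_copairing: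
  assumes "c \<in> carrier C"
  shows "group_hom D (integer_mod_group p) (\<lambda>\<phi>. P \<phi> c)"
  using assms pairing_hom
  by (auto simp: group_hom_def group_hom_axioms_def hom_def Pi_iff pairing_add)

lemma subgroup_annihilator:
  assumes "S \<subseteq> carrier C"
  shows "subgroup (annihilator S) D"
proof (rule D.subgroupI)
  show "annihilator S \<subseteq> carrier D"
    by (auto simp: annihilator_def)
  have "\<one>\<^bsub>D\<^esub> \<in> annihilator S"
    using assms group_hom.hom_one[OF group_hom_copairing] by (auto simp: annihilator_def)
  then show "annihilator S \<noteq> {}"
    by blast
  show "inv\<^bsub>D\<^esub> a \<in> annihilator S" if "a \<in> annihilator S" for a
    using that assms group_hom.hom_inv[OF group_hom_copairing]
    by (auto simp: annihilator_def subset_iff)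
  show "a \<otimes>\<^bsub>D\<^esub> b \<in> annihilator S" if "a \<in> annihilator S" "b \<in> annihilator S" for a b
    using that assms by (auto simp: annihilator_def subset_iff pairing_add)
qed

lemma subgroup_coannihilator:
  assumes "R \<subseteq> carrier D"
  shows "subgroup (coannihilator R) C"
proof (rule C.subgroupI)
  show "coannihilator R \<subseteq> carrier C"
    by (auto simp: coannihilator_def)
  have "\<one> \<in> coannihilator R"
    using assms group_hom.hom_one[OF group_hom_pairing] by (auto simp: coannihilator_def)
  then show "coannihilator R \<noteq> {}"
    by blast
  show "inv a \<in> coannihilator R" if "a \<in> coannihilator R" for a
    using that assms group_hom.hom_inv[OF group_hom_pairing]
    by (auto simp: coannihilator_def subset_iff)
  show "a \<otimes> b \<in> coannihilator R" if "a \<in> coannihilator R" "b \<in> coannihilator R" for a b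
    using that assms group_hom.hom_mult[OF group_hom_pairing]
    by (auto simp: coannihilator_def subset_iff)
qed

text \<open>The values of \<open>P\<close> are representatives between 0 and p - 1, so congruence
  modulo \<open>p\<close> is equality.\<close>

lemma pairing_diff:
  assumes "\<phi> \<in> carrier D" "a \<in> carrier C" "b \<in> carrier C"
  shows "P \<phi> (a \<otimes> inv b) = 0 \<longleftrightarrow> P \<phi> a = P \<phi> b"
proof -
  interpret \<phi>: group_hom C "integer_mod_group p" "P \<phi>"
    using group_hom_pairing[OF assms(1)] .
  have "P \<phi> (a \<otimes> inv b) = (P \<phi> a - P \<phi> b) mod int p"
    using assms by (simp add: mod_simps)
  then show ?thesis
    using hom_integer_mod_group_range[OF pairing_hom[OF assms(1)] _ C.p_pos] assms
    by (metis diff_self dvd_eq_mod_eq_0 mod_0 mod_eq_dvd_iff mod_pos_pos_trivial)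
qed

lemma copairing_diff:
  assumes "\<phi> \<in> carrier D" "\<psi> \<in> carrier D" "c \<in> carrier C"
  shows "P (\<phi> \<otimes>\<^bsub>D\<^esub> inv\<^bsub>D\<^esub> \<psi>) c = 0 \<longleftrightarrow> P \<phi> c = P \<psi> c"
proof -
  interpret c: group_hom D "integer_mod_group p" "\<lambda>\<phi>. P \<phi> c"
    using group_hom_copairing[OF assms(3)] .
  have "P (\<phi> \<otimes>\<^bsub>D\<^esub> inv\<^bsub>D\<^esub> \<psi>) c = (P \<phi> c - P \<psi> c) mod int p"
    using assms c.hom_inv[OF assms(2)] c.H.inv_closed by (simp add: pairing_add mod_simps)
  then show ?thesis
    using hom_integer_mod_group_range[OF pairing_hom _ C.p_pos] assms
    by (metis diff_self dvd_eq_mod_eq_0 mod_0 mod_eq_dvd_iff mod_pos_pos_trivial)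
qed

text \<open>The quotient \<open>annihilator B / annihilator Z\<close> is the dual of \<open>Z / B\<close>.\<close>

theorem quotient_iso_iff_dual_iso:
  assumes Z: "subgroup Z C" and B: "subgroup B C" and f: "f \<in> hom C C" and g: "g \<in> hom D D"
    and adj: "\<And>\<phi> c. \<phi> \<in> carrier D \<Longrightarrow> c \<in> carrier C \<Longrightarrow> P (g \<phi>) c = P \<phi> (f c)"
    and fZ: "f ` Z \<subseteq> Z" and fB: "f ` B \<subseteq> B"
  shows "(\<lambda>A. B <#> f ` A) \<in> iso (subgroup_generated C Z Mod B) (subgroup_generated C Z Mod B)
    \<longleftrightarrow> (\<lambda>A. annihilator Z <#>\<^bsub>D\<^esub> g ` A)
      \<in> iso (subgroup_generated D (annihilator B) Mod annihilator Z)
            (subgroup_generated D (annihilator B) Mod annihilator Z)"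
proof -
  note Zc = subgroup.mem_carrier[OF Z] and Bc = subgroup.mem_carrier[OF B]
  interpret f: group_hom C C f
    using f by unfold_locales
  have gc: "g \<phi> \<in> carrier D" if "\<phi> \<in> carrier D" for \<phi>
    using g that by (auto simp: hom_def)
  have sub: "subgroup (annihilator Z) D" "subgroup (annihilator B) D"
    using subgroup_annihilator Zc Bc by blast+
  have g_inv: "g ` annihilator Z \<subseteq> annihilator Z" "g ` annihilator B \<subseteq> annihilator B"
    using fZ fB Zc Bc by (auto simp: annihilator_def adj gc)
  let ?inj = "\<forall>z\<in>Z. f z \<in> B \<longrightarrow> z \<in> B"
  let ?surj = "\<forall>z\<in>Z. \<exists>z'\<in>Z. z \<otimes> inv (f z') \<in> B"
  let ?inj' = "\<forall>\<phi>\<in>annihilator B. g \<phi> \<in> annihilator Z \<longrightarrow> \<phi> \<in> annihilator Z"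
  let ?surj' = "\<forall>\<phi>\<in>annihilator B. \<exists>\<phi>'\<in>annihilator B. \<phi> \<otimes>\<^bsub>D\<^esub> inv\<^bsub>D\<^esub> (g \<phi>') \<in> annihilator Z"
  \<comment> \<open>Modulo \<open>B\<close>, each element of \<open>Z\<close> is some
    \<open>f z'\<close>, and a functional that kills \<open>B\<close> and whose pullback kills
    \<open>Z\<close> vanishes there.\<close>
  have "?surj \<Longrightarrow> ?inj'"
  proof (intro ballI impI)
    fix \<phi> assume surj: ?surj and \<phi>: "\<phi> \<in> annihilator B" "g \<phi> \<in> annihilator Z"
    then have \<phi>c: "\<phi> \<in> carrier D" by (simp add: annihilator_def)
    have "P \<phi> z = 0" if z: "z \<in> Z" for z
    proof -
      obtain z' where z': "z' \<in> Z" "z \<otimes> inv (f z') \<in> B"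
        using surj z by blast
      then have "P \<phi> z = P \<phi> (f z')"
        using z \<phi> \<phi>c Zc pairing_diff[OF \<phi>c, of z "f z'"] by (auto simp: annihilator_def)
      also have "\<dots> = 0"
        using \<phi> \<phi>c z' Zc by (simp add: annihilator_def flip: adj)
      finally show ?thesis .
    qed
    then show "\<phi> \<in> annihilator Z"
      using \<phi>c by (simp add: annihilator_def)
  qed
  \<comment> \<open>If \<open>v\<close> in \<open>Z\<close> is missed by B f(Z), a functional that
    kills this subgroup but not \<open>v\<close> contradicts injectivity of the dual map.\<close>
  moreover have "?inj' \<Longrightarrow> ?surj"
  proof (rule ccontr)
    assume inj': ?inj' and "\<not> ?surj"
    then obtain v where v: "v \<in> Z" and vn: "\<And>z'. z' \<in> Z \<Longrightarrow> v \<otimes> inv (f z') \<notin> B" by blast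
    define W where "W = B <#> f ` Z"
    have W: "subgroup W C"
      unfolding W_def using C.mult_subgroups[OF B f.subgroup_img_is_subgroup[OF Z]] .
    have "v \<notin> W"
    proof
      assume "v \<in> W"
      then obtain b z where bz: "b \<in> B" "z \<in> Z" "v = b \<otimes> f z"
        by (auto simp: W_def set_mult_def)
      then have "v \<otimes> inv (f z) = b"
        using Zc Bc by (simp add: C.m_assoc)
      then show False
        using bz vn[OF bz(2)] by simp
    qed
    then obtain \<psi> where \<psi>: "\<psi> \<in> hom C (integer_mod_group p)" "\<And>w. w \<in> W \<Longrightarrow> \<psi> w = 0" "\<psi> v = 1"
      using C.exists_separating_functional[OF W Zc[OF v]] by blast
    obtain \<phi> where \<phi>: "\<phi> \<in> carrier D" "\<And>c. c \<in> carrier C \<Longrightarrow> P \<phi> c = \<psi> c"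
      using pairing_represents[OF \<psi>(1)] by blast
    have "b \<in> W" if "b \<in> B" for b
    proof -
      have "b = b \<otimes> f \<one>" using that Bc by simp
      then show ?thesis
        unfolding W_def set_mult_def using that subgroup.one_closed[OF Z] by blast
    qed
    then have "\<phi> \<in> annihilator B"
      using \<phi> \<psi>(2) Bc by (auto simp: annihilator_def)
    moreover have "f z \<in> W" if "z \<in> Z" for z
    proof -
      have "f z = \<one> \<otimes> f z" using that Zc by simp
      then show ?thesis
        unfolding W_def set_mult_def using that subgroup.one_closed[OF B] by blast
    qed
    then have "g \<phi> \<in> annihilator Z"
      using \<phi> \<psi>(2) Zc by (auto simp: annihilator_def adj gc)
    ultimately have "\<phi> \<in> annihilator Z"
      using inj' by blast
    then show False
      using v Zc \<phi> \<psi>(3) by (auto simp: annihilator_def)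
  qed
  \<comment> \<open>For \<open>z\<close> outside \<open>B\<close> with \<open>f z\<close> in
    \<open>B\<close>, take a functional that kills \<open>B\<close> and has value 1 at
    \<open>z\<close>. On \<open>Z\<close> it agrees with some \<open>g \<phi>'\<close>, whose value
    at \<open>z\<close> is that of \<open>\<phi>'\<close> at \<open>f z\<close>, namely 0.\<close>
  moreover have "?surj' \<Longrightarrow> ?inj"
  proof (intro ballI impI, rule ccontr)
    fix z assume surj': ?surj' and z: "z \<in> Z" "f z \<in> B" "z \<notin> B"
    then obtain \<psi> where \<psi>: "\<psi> \<in> hom C (integer_mod_group p)" "\<And>w. w \<in> B \<Longrightarrow> \<psi> w = 0" "\<psi> z = 1"
      using C.exists_separating_functional[OF B Zc[OF z(1)]] by blast
    obtain \<phi> where \<phi>: "\<phi> \<in> carrier D" "\<And>c. c \<in> carrier C \<Longrightarrow> P \<phi> c = \<psi> c"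
      using pairing_represents[OF \<psi>(1)] by blast
    have "\<phi> \<in> annihilator B"
      using \<phi> \<psi>(2) Bc by (auto simp: annihilator_def)
    then obtain \<phi>' where \<phi>': "\<phi>' \<in> annihilator B" "\<phi> \<otimes>\<^bsub>D\<^esub> inv\<^bsub>D\<^esub> (g \<phi>') \<in> annihilator Z"
      using surj' by blast
    then have \<phi>'c: "\<phi>' \<in> carrier D" by (simp add: annihilator_def)
    then have "P \<phi> z = P (g \<phi>') z"
      using copairing_diff[OF \<phi>(1) gc[OF \<phi>'c] Zc[OF z(1)]] \<phi>'(2) z by (auto simp: annihilator_def)
    also have "\<dots> = 0"
      using adj[OF \<phi>'c Zc[OF z(1)]] \<phi>'(1) z by (simp add: annihilator_def)
    finally show False
      using \<phi> \<psi>(3) Zc z by simp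
  qed
  \<comment> \<open>Injectivity says that \<open>\<phi>\<close> restricted to \<open>Z\<close>
    vanishes wherever \<open>f\<close> lands in \<open>B\<close>. So it factors through
    \<open>f\<close> modulo \<open>B\<close>, and the factor is the preimage sought. Passing to
    \<open>subgroup_generated C Z\<close> as domain confines the kernel condition to
    \<open>Z\<close>.\<close>
  moreover have "?inj \<Longrightarrow> ?surj'"
  proof
    fix \<phi> assume inj: ?inj and \<phi>: "\<phi> \<in> annihilator B"
    then have \<phi>c: "\<phi> \<in> carrier D" by (simp add: annihilator_def)
    let ?Z = "subgroup_generated C Z"
    have cZ: "carrier ?Z = Z"
      using subgroup.carrier_subgroup_generated_subgroup[OF Z] .
    have "P \<phi> a = 0" if "a \<in> carrier ?Z" "f a \<in> B" for a
      using that inj \<phi> by (auto simp: cZ annihilator_def)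
    then obtain \<psi> where \<psi>: "\<psi> \<in> hom C (integer_mod_group p)" "\<And>b. b \<in> B \<Longrightarrow> \<psi> b = 0"
      "\<And>a. a \<in> carrier ?Z \<Longrightarrow> \<psi> (f a) = P \<phi> a"
      using C.functional_factors_through[OF C.group_subgroup_generated C.hom_from_subgroup_generated[OF f]
          C.hom_from_subgroup_generated[OF pairing_hom[OF \<phi>c]] B] by blast
    obtain \<phi>' where \<phi>': "\<phi>' \<in> carrier D" "\<And>c. c \<in> carrier C \<Longrightarrow> P \<phi>' c = \<psi> c"
      using pairing_represents[OF \<psi>(1)] by blast
    have "\<phi>' \<in> annihilator B"
      using \<phi>' \<psi>(2) Bc by (auto simp: annihilator_def)
    moreover have "P (\<phi> \<otimes>\<^bsub>D\<^esub> inv\<^bsub>D\<^esub> (g \<phi>')) z = 0" if "z \<in> Z" for z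
      using that copairing_diff[OF \<phi>c gc[OF \<phi>'(1)] Zc] \<psi>(3) \<phi>' Zc by (simp add: adj cZ)
    then have "\<phi> \<otimes>\<^bsub>D\<^esub> inv\<^bsub>D\<^esub> (g \<phi>') \<in> annihilator Z"
      using \<phi>c gc[OF \<phi>'(1)] by (simp add: annihilator_def)
    ultimately show "\<exists>\<phi>'\<in>annihilator B. \<phi> \<otimes>\<^bsub>D\<^esub> inv\<^bsub>D\<^esub> (g \<phi>') \<in> annihilator Z"
      by blast
  qed
  ultimately show ?thesis
    unfolding C.induced_quotient_iso_iff[OF Z B f fZ fB]
      D.induced_quotient_iso_iff[OF sub(2) sub(1) g g_inv(2) g_inv(1)]
    by blast
qed

end

section \<open>The pairing of cochains with chains\<close>

text \<open>The linear algebra is done over an arbitrary index set \<open>S\<close>, later the set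
  of singular simplices of one dimension.\<close>

abbreviation mod_chains :: "nat \<Rightarrow> 's set \<Rightarrow> ('s \<Rightarrow> int) monoid" where
  "mod_chains p S \<equiv> sum_group S (\<lambda>_. integer_mod_group p)"

abbreviation mod_cochains :: "nat \<Rightarrow> 's set \<Rightarrow> ('s \<Rightarrow> int) monoid" where
  "mod_cochains p S \<equiv> product_group S (\<lambda>_. integer_mod_group p)"

definition evaluation :: "nat \<Rightarrow> 's set \<Rightarrow> ('s \<Rightarrow> int) \<Rightarrow> ('s \<Rightarrow> int) \<Rightarrow> int" where
  "evaluation p S \<phi> c = (\<Sum>\<sigma>\<in>{\<sigma> \<in> S. c \<sigma> \<noteq> 0}. \<phi> \<sigma> * c \<sigma>) mod int p"

text \<open>The elementary chain supported at \<open>\<sigma>\<close>. With \<open>k = 1\<close> it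
  doubles as the indicator cochain that reads off a coefficient. The restriction to \<open>S\<close>
  makes it extensional, as elements of both groups have to be.\<close>

definition single :: "'s set \<Rightarrow> 's \<Rightarrow> int \<Rightarrow> 's \<Rightarrow> int" where
  "single S \<sigma> k = (\<lambda>\<tau>\<in>S. if \<tau> = \<sigma> then k else 0)"

lemma mod_chains_iff:
  "c \<in> carrier (mod_chains p S) \<longleftrightarrow>
     c \<in> extensional S \<and> (\<forall>\<sigma>\<in>S. c \<sigma> \<in> carrier (integer_mod_group p)) \<and> finite {\<sigma> \<in> S. c \<sigma> \<noteq> 0}"
  by (auto simp: carrier_sum_group PiE_iff)

lemma mod_cochains_iff:
  "\<phi> \<in> carrier (mod_cochains p S) \<longleftrightarrow>
     \<phi> \<in> extensional S \<and> (\<forall>\<sigma>\<in>S. \<phi> \<sigma> \<in> carrier (integer_mod_group p))"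
  by (auto simp: PiE_iff)

text \<open>Supports vary under addition, since coefficients may cancel; a common finite index set
  makes sums comparable.\<close>

lemma evaluation_superset:
  assumes "finite A" "A \<subseteq> S" "\<And>\<sigma>. \<sigma> \<in> S \<Longrightarrow> c \<sigma> \<noteq> 0 \<Longrightarrow> \<sigma> \<in> A"
  shows "evaluation p S \<phi> c = (\<Sum>\<sigma>\<in>A. \<phi> \<sigma> * c \<sigma>) mod int p"
proof -
  have "(\<Sum>\<sigma>\<in>{\<sigma> \<in> S. c \<sigma> \<noteq> 0}. \<phi> \<sigma> * c \<sigma>) = (\<Sum>\<sigma>\<in>A. \<phi> \<sigma> * c \<sigma>)"
    using assms by (intro sum.mono_neutral_left) auto
  then show ?thesis
    by (simp add: evaluation_def)
qed

lemma sum_mod_cong: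
  fixes f g :: "'i \<Rightarrow> 'n::euclidean_semiring_cancel"
  assumes "\<And>i. i \<in> A \<Longrightarrow> f i mod m = g i mod m"
  shows "sum f A mod m = sum g A mod m"
proof -
  have "(\<Sum>i\<in>A. f i mod m) = (\<Sum>i\<in>A. g i mod m)"
    using assms by (rule sum.cong[OF refl])
  then show ?thesis
    by (metis mod_sum_eq)
qed

lemma finprod_integer_mod_group:
  assumes "finite A" "\<And>i. i \<in> A \<Longrightarrow> w i \<in> carrier (integer_mod_group p)"
  shows "finprod (integer_mod_group p) w A = (\<Sum>i\<in>A. w i) mod int p"
  using assms
proof (induction A)
  case empty
  interpret comm_group "integer_mod_group p" by simp
  show ?case by simp
next
  case (insert x A)
  interpret comm_group "integer_mod_group p" by simp
  show ?case
    using insert by (simp add: Pi_iff mod_simps)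
qed

context
  fixes p :: nat
  assumes p: "prime p"
begin

lemma carrier_mod: "carrier (integer_mod_group p) = {0..<int p}"
  using prime_gt_0_nat[OF p] by (simp add: carrier_integer_mod_group)

lemma mod_in_carrier: "k mod int p \<in> carrier (integer_mod_group p)"
  using prime_gt_0_nat[OF p] by (simp add: carrier_mod)

lemma carrier_mod_trivial: "k \<in> carrier (integer_mod_group p) \<Longrightarrow> k mod int p = k"
  by (simp add: carrier_mod)

lemma evaluation_in_carrier: "evaluation p S \<phi> c \<in> carrier (integer_mod_group p)"
  unfolding evaluation_def by (rule mod_in_carrier)

lemma evaluation_add_right:
  assumes "c \<in> carrier (mod_chains p S)" "d \<in> carrier (mod_chains p S)"
  shows "evaluation p S \<phi> (c \<otimes>\<^bsub>mod_chains p S\<^esub> d) = (evaluation p S \<phi> c + evaluation p S \<phi> d) mod int p"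
proof -
  define A where "A = {\<sigma> \<in> S. c \<sigma> \<noteq> 0} \<union> {\<sigma> \<in> S. d \<sigma> \<noteq> 0}"
  have A: "finite A" "A \<subseteq> S"
    using assms by (auto simp: A_def mod_chains_iff)
  have "evaluation p S \<phi> (c \<otimes>\<^bsub>mod_chains p S\<^esub> d) = (\<Sum>\<sigma>\<in>A. \<phi> \<sigma> * ((c \<sigma> + d \<sigma>) mod int p)) mod int p"
    using A by (subst evaluation_superset[OF A]) (auto simp: A_def intro!: arg_cong[where f = "\<lambda>x. x mod int p"] sum.cong)
  also have "\<dots> = (\<Sum>\<sigma>\<in>A. \<phi> \<sigma> * (c \<sigma> + d \<sigma>)) mod int p"
    by (intro sum_mod_cong) (simp add: mod_mult_right_eq)
  also have "\<dots> = ((\<Sum>\<sigma>\<in>A. \<phi> \<sigma> * c \<sigma>) mod int p + (\<Sum>\<sigma>\<in>A. \<phi> \<sigma> * d \<sigma>) mod int p) mod int p"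
    by (simp add: distrib_left sum.distrib mod_add_eq)
  also have "\<dots> = (evaluation p S \<phi> c + evaluation p S \<phi> d) mod int p"
    using A by (subst (1 2) evaluation_superset[OF A]) (auto simp: A_def)
  finally show ?thesis .
qed

lemma evaluation_add_left:
  assumes "c \<in> carrier (mod_chains p S)"
  shows "evaluation p S (\<phi> \<otimes>\<^bsub>mod_cochains p S\<^esub> \<psi>) c = (evaluation p S \<phi> c + evaluation p S \<psi> c) mod int p"
proof -
  let ?A = "{\<sigma> \<in> S. c \<sigma> \<noteq> 0}"
  have "evaluation p S (\<phi> \<otimes>\<^bsub>mod_cochains p S\<^esub> \<psi>) c = (\<Sum>\<sigma>\<in>?A. ((\<phi> \<sigma> + \<psi> \<sigma>) mod int p) * c \<sigma>) mod int p"
    unfolding evaluation_def by (auto intro!: arg_cong[where f = "\<lambda>x. x mod int p"] sum.cong)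
  also have "\<dots> = (\<Sum>\<sigma>\<in>?A. (\<phi> \<sigma> + \<psi> \<sigma>) * c \<sigma>) mod int p"
    by (intro sum_mod_cong) (simp add: mod_mult_left_eq)
  also have "\<dots> = (evaluation p S \<phi> c + evaluation p S \<psi> c) mod int p"
    by (simp add: evaluation_def distrib_right sum.distrib mod_add_eq)
  finally show ?thesis .
qed

lemma single_in_chains:
  "k \<in> carrier (integer_mod_group p) \<Longrightarrow> single S \<sigma> k \<in> carrier (mod_chains p S)"
  by (auto simp: mod_chains_iff single_def intro: finite_subset[of _ "{\<sigma>}"])

lemma evaluation_single_right:
  assumes "\<sigma> \<in> S"
  shows "evaluation p S \<phi> (single S \<sigma> k) = (\<phi> \<sigma> * k) mod int p"
  using assms by (subst evaluation_superset[of "{\<sigma>}"]) (auto simp: single_def split: if_splits)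

lemma evaluation_single_left:
  assumes "\<sigma> \<in> S" "c \<in> carrier (mod_chains p S)"
  shows "evaluation p S (single S \<sigma> 1) c = c \<sigma>"
proof -
  have "evaluation p S (single S \<sigma> 1) c = (\<Sum>\<tau>\<in>insert \<sigma> {\<tau> \<in> S. c \<tau> \<noteq> 0}. single S \<sigma> 1 \<tau> * c \<tau>) mod int p"
    using assms by (intro evaluation_superset) (auto simp: mod_chains_iff)
  also have "\<dots> = (\<Sum>\<tau>\<in>{\<sigma>}. single S \<sigma> 1 \<tau> * c \<tau>) mod int p"
    using assms by (intro arg_cong[where f = "\<lambda>x. x mod int p"] sum.mono_neutral_right)
      (auto simp: mod_chains_iff single_def)
  also have "\<dots> = c \<sigma>"
    using assms by (simp add: single_def mod_chains_iff carrier_mod_trivial)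
  finally show ?thesis .
qed

text \<open>The indicator cochain of a simplex reads off its coefficient. This is how identities of
  chains are transferred to the cochain side.\<close>

lemma chain_eqI:
  assumes "c \<in> carrier (mod_chains p S)" "d \<in> carrier (mod_chains p S)"
    and "\<And>\<phi>. \<phi> \<in> carrier (mod_cochains p S) \<Longrightarrow> evaluation p S \<phi> c = evaluation p S \<phi> d"
  shows "c = d"
proof (rule extensionalityI)
  show "c \<in> extensional S" "d \<in> extensional S"
    using assms by (auto simp: mod_chains_iff)
  fix \<sigma> assume "\<sigma> \<in> S"
  moreover have "single S \<sigma> 1 \<in> carrier (mod_cochains p S)"
    using prime_gt_1_nat[OF p] by (auto simp: mod_cochains_iff carrier_mod single_def)
  ultimately show "c \<sigma> = d \<sigma>"
    using assms evaluation_single_left by metis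
qed

lemma cochain_eqI:
  assumes "\<phi> \<in> carrier (mod_cochains p S)" "\<psi> \<in> carrier (mod_cochains p S)"
    and "\<And>c. c \<in> carrier (mod_chains p S) \<Longrightarrow> evaluation p S \<phi> c = evaluation p S \<psi> c"
  shows "\<phi> = \<psi>"
proof (rule extensionalityI)
  show "\<phi> \<in> extensional S" "\<psi> \<in> extensional S"
    using assms unfolding mod_cochains_iff by blast+
  fix \<sigma> assume \<sigma>: "\<sigma> \<in> S"
  have "single S \<sigma> 1 \<in> carrier (mod_chains p S)"
    using prime_gt_1_nat[OF p] by (intro single_in_chains) (simp add: carrier_mod)
  from assms(3)[OF this] show "\<phi> \<sigma> = \<psi> \<sigma>"
    using \<sigma> assms unfolding mod_cochains_iff by (simp add: evaluation_single_right carrier_mod_trivial)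
qed

text \<open>Cochains are the full dual of chains: a chain is a finite sum of elementary ones, so a
  functional is known from its values on those.\<close>

lemma functional_eq_evaluation:
  assumes h: "h \<in> hom (mod_chains p S) (integer_mod_group p)" and c: "c \<in> carrier (mod_chains p S)"
  shows "h c = evaluation p S (\<lambda>\<sigma>\<in>S. h (single S \<sigma> 1)) c"
proof -
  let ?\<phi> = "\<lambda>\<sigma>\<in>S. h (single S \<sigma> 1)"
  interpret h: group_hom "mod_chains p S" "integer_mod_group p" h
    using h by (simp add: group_hom_def group_hom_axioms_def)
  have one: "1 \<in> carrier (integer_mod_group p)"
    using prime_gt_1_nat[OF p] by (simp add: carrier_mod)
  \<comment> \<open>As a function of the coefficient this is an endomorphism of Z/p, hence
    determined by its value at the generator 1.\<close>
  have h_single: "h (single S \<sigma> k) = (h (single S \<sigma> 1) * k) mod int p"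
    if "k \<in> carrier (integer_mod_group p)" for \<sigma> k
  proof -
    have "(\<lambda>k. h (single S \<sigma> k)) \<in> hom (integer_mod_group p) (integer_mod_group p)"
    proof (rule homI)
      show "h (single S \<sigma> k) \<in> carrier (integer_mod_group p)" if "k \<in> carrier (integer_mod_group p)" for k
        using single_in_chains[OF that] by (rule h.hom_closed)
      fix k l assume kl: "k \<in> carrier (integer_mod_group p)" "l \<in> carrier (integer_mod_group p)"
      have "single S \<sigma> (k \<otimes>\<^bsub>integer_mod_group p\<^esub> l) = single S \<sigma> k \<otimes>\<^bsub>mod_chains p S\<^esub> single S \<sigma> l"
        by (auto simp: single_def)
      then show "h (single S \<sigma> (k \<otimes>\<^bsub>integer_mod_group p\<^esub> l))
          = h (single S \<sigma> k) \<otimes>\<^bsub>integer_mod_group p\<^esub> h (single S \<sigma> l)"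
        using h.hom_mult[OF single_in_chains[OF kl(1)] single_in_chains[OF kl(2)]] by simp
    qed
    from hom_integer_mod_group_int_pow[OF _ this one, of k] show ?thesis
      using that by (simp add: int_pow_integer_mod_group carrier_mod_trivial mult.commute)
  qed
  \<comment> \<open>The induction runs over a finite set containing the support, so that erasing one
    coefficient fits the hypothesis even if that coefficient was already 0.\<close>
  have "h c = evaluation p S ?\<phi> c"
    if "finite A" "A \<subseteq> S" "\<And>\<sigma>. \<sigma> \<in> S \<Longrightarrow> c \<sigma> \<noteq> 0 \<Longrightarrow> \<sigma> \<in> A" "c \<in> carrier (mod_chains p S)" for A c
    using that
  proof (induction A arbitrary: c)
    case empty
    then have "c = \<one>\<^bsub>mod_chains p S\<^esub>"
      by (intro extensionalityI[of _ S]) (auto simp: mod_chains_iff)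
    then show ?case
      using h.hom_one by (simp only: evaluation_def) simp
  next
    case (insert \<sigma> A)
    define d where "d = c(\<sigma> := 0)"
    have c\<sigma>: "c \<sigma> \<in> carrier (integer_mod_group p)"
      using insert.prems by (simp add: mod_chains_iff)
    have "finite {\<tau> \<in> S. d \<tau> \<noteq> 0}"
      using insert.prems(3) by (auto simp: mod_chains_iff d_def intro: rev_finite_subset)
    then have d: "d \<in> carrier (mod_chains p S)"
      using insert.prems by (auto simp: mod_chains_iff d_def extensional_def)
    have s: "single S \<sigma> (c \<sigma>) \<in> carrier (mod_chains p S)"
      using single_in_chains[OF c\<sigma>] .
    have c_eq: "c = d \<otimes>\<^bsub>mod_chains p S\<^esub> single S \<sigma> (c \<sigma>)"
    proof (rule extensionalityI[of _ S])
      show "c \<in> extensional S"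
        using insert.prems by (simp add: mod_chains_iff)
      show "c \<tau> = (d \<otimes>\<^bsub>mod_chains p S\<^esub> single S \<sigma> (c \<sigma>)) \<tau>" if "\<tau> \<in> S" for \<tau>
        using that insert.prems by (auto simp: d_def single_def mod_chains_iff carrier_mod_trivial)
    qed simp
    have "h c = (h d + h (single S \<sigma> (c \<sigma>))) mod int p"
      using h.hom_mult[OF d s] c_eq by simp
    also have "h d = evaluation p S ?\<phi> d"
    proof (rule insert.IH)
      show "A \<subseteq> S"
        using insert.prems(1) by blast
      show "\<tau> \<in> A" if "\<tau> \<in> S" "d \<tau> \<noteq> 0" for \<tau>
        using that insert.prems(2)[of \<tau>] by (auto simp: d_def split: if_splits)
    qed (fact d)
    also have "h (single S \<sigma> (c \<sigma>)) = evaluation p S ?\<phi> (single S \<sigma> (c \<sigma>))"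
      using insert.prems by (simp add: h_single[OF c\<sigma>] evaluation_single_right)
    also have "(evaluation p S ?\<phi> d + evaluation p S ?\<phi> (single S \<sigma> (c \<sigma>))) mod int p = evaluation p S ?\<phi> c"
      using evaluation_add_right[OF d s] c_eq by simp
    finally show ?case .
  qed
  from this[of "{\<sigma> \<in> S. c \<sigma> \<noteq> 0}" c] show ?thesis
    using c by (auto simp: mod_chains_iff)
qed

text \<open>Powers are not computed coefficientwise: every cochain evaluates the p-th power to a
  multiple of \<open>p\<close>, hence to 0, and cochains separate chains.\<close>

lemma exponent_group_mod_chains: "exponent_group (mod_chains p S) p"
proof -
  interpret group "mod_chains p S" by simp
  have "comm_group (mod_chains p S)"
    by (rule group_comm_groupI) (simp add: add.commute)
  moreover have "x [^]\<^bsub>mod_chains p S\<^esub> p = \<one>\<^bsub>mod_chains p S\<^esub>" if x: "x \<in> carrier (mod_chains p S)" for x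
  proof (rule chain_eqI[of _ S])
    fix \<phi>
    have h: "evaluation p S \<phi> \<in> hom (mod_chains p S) (integer_mod_group p)"
      using evaluation_add_right evaluation_in_carrier by (intro homI) auto
    have "evaluation p S \<phi> (x [^]\<^bsub>mod_chains p S\<^esub> int p) = (int p * evaluation p S \<phi> x) mod int p"
      using hom_integer_mod_group_int_pow[OF is_group h x] .
    then show "evaluation p S \<phi> (x [^]\<^bsub>mod_chains p S\<^esub> p) = evaluation p S \<phi> \<one>\<^bsub>mod_chains p S\<^esub>"
      by (simp add: int_pow_int evaluation_def)
  qed (use x in \<open>auto simp del: one_sum_group\<close>)
  ultimately show ?thesis
    using p by (simp add: exponent_group_def exponent_group_axioms_def)
qed

lemma comm_group_mod_cochains: "comm_group (mod_cochains p S)"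
  by (rule group.group_comm_groupI) (auto simp: add.commute)

lemma perfect_pairing_evaluation:
  "perfect_pairing (mod_chains p S) p (mod_cochains p S) (evaluation p S)"
proof -
  have "evaluation p S \<phi> \<in> hom (mod_chains p S) (integer_mod_group p)" for \<phi>
    using evaluation_add_right evaluation_in_carrier by (intro homI) auto
  moreover have "\<exists>\<phi>\<in>carrier (mod_cochains p S). \<forall>c\<in>carrier (mod_chains p S). evaluation p S \<phi> c = h c"
    if h: "h \<in> hom (mod_chains p S) (integer_mod_group p)" for h
  proof
    have "1 \<in> carrier (integer_mod_group p)"
      using prime_gt_1_nat[OF p] by (simp add: carrier_mod)
    then have "h (single S \<sigma> 1) \<in> carrier (integer_mod_group p)" for \<sigma>
      using single_in_chains[of 1 S \<sigma>] h unfolding hom_def Pi_iff by blast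
    then show "(\<lambda>\<sigma>\<in>S. h (single S \<sigma> 1)) \<in> carrier (mod_cochains p S)"
      by (auto simp: mod_cochains_iff)
    show "\<forall>c\<in>carrier (mod_chains p S). evaluation p S (\<lambda>\<sigma>\<in>S. h (single S \<sigma> 1)) c = h c"
      using functional_eq_evaluation[OF h] by simp
  qed
  ultimately show ?thesis
    using exponent_group_mod_chains[of S] comm_group_mod_cochains[of S] evaluation_add_left
    by (auto simp add: perfect_pairing_def perfect_pairing_axioms_def simp del: mult_product_group)
qed

text \<open>Evaluating \<open>L' \<phi>\<close> is additive in the chain, so additivity of
  \<open>L\<close> follows by testing against all cochains.\<close>

lemma hom_of_adjoint:
  assumes L: "\<And>c. c \<in> carrier (mod_chains p S) \<Longrightarrow> L c \<in> carrier (mod_chains p T)"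
    and adj: "\<And>\<phi> c. \<phi> \<in> carrier (mod_cochains p T) \<Longrightarrow> c \<in> carrier (mod_chains p S) \<Longrightarrow>
      evaluation p T \<phi> (L c) = evaluation p S (L' \<phi>) c"
  shows "L \<in> hom (mod_chains p S) (mod_chains p T)"
proof (rule homI)
  interpret S: group "mod_chains p S" by simp
  interpret T: group "mod_chains p T" by simp
  fix c d assume cd: "c \<in> carrier (mod_chains p S)" "d \<in> carrier (mod_chains p S)"
  show "L (c \<otimes>\<^bsub>mod_chains p S\<^esub> d) = L c \<otimes>\<^bsub>mod_chains p T\<^esub> L d"
  proof (rule chain_eqI)
    show "L (c \<otimes>\<^bsub>mod_chains p S\<^esub> d) \<in> carrier (mod_chains p T)"
      using cd L S.m_closed by blast
    show "L c \<otimes>\<^bsub>mod_chains p T\<^esub> L d \<in> carrier (mod_chains p T)"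
      using cd L T.m_closed by blast
    fix \<phi> assume \<phi>: "\<phi> \<in> carrier (mod_cochains p T)"
    have "evaluation p T \<phi> (L (c \<otimes>\<^bsub>mod_chains p S\<^esub> d))
        = (evaluation p S (L' \<phi>) c + evaluation p S (L' \<phi>) d) mod int p"
      using cd by (simp only: adj[OF \<phi>] S.m_closed evaluation_add_right)
    also have "\<dots> = evaluation p T \<phi> (L c \<otimes>\<^bsub>mod_chains p T\<^esub> L d)"
      using cd by (simp only: adj[OF \<phi>] L evaluation_add_right)
    finally show "evaluation p T \<phi> (L (c \<otimes>\<^bsub>mod_chains p S\<^esub> d))
        = evaluation p T \<phi> (L c \<otimes>\<^bsub>mod_chains p T\<^esub> L d)" .
  qed
qed (use L in blast)

text \<open>The common form of chain map and boundary: finitely many weighted simplices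
  \<open>t i\<close>, with weights collected over the fibres of \<open>t\<close>. The evaluation
  formula regroups the sum over \<open>I\<close> by these fibres.\<close>

lemma pushforward:
  fixes w :: "'i \<Rightarrow> int"
  assumes I: "finite I" and t: "\<And>i. i \<in> I \<Longrightarrow> t i \<in> T"
    and w: "\<And>i. i \<in> I \<Longrightarrow> w i \<in> carrier (integer_mod_group p)"
  defines "d \<equiv> \<lambda>\<tau>\<in>T. finprod (integer_mod_group p) w {i \<in> I. t i = \<tau>}"
  shows "d \<in> carrier (mod_chains p T)"
    and "evaluation p T \<phi> d = (\<Sum>i\<in>I. \<phi> (t i) * w i) mod int p"
proof -
  have d: "d \<tau> = (\<Sum>i\<in>{i \<in> I. t i = \<tau>}. w i) mod int p" if "\<tau> \<in> T" for \<tau>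
    unfolding d_def restrict_apply' [OF that] using I w by (intro finprod_integer_mod_group) auto
  \<comment> \<open>Off the image of \<open>t\<close> the product is empty, which gives finite
    support although \<open>T\<close> may be infinite.\<close>
  have supp: "\<tau> \<in> t ` I" if "\<tau> \<in> T" "d \<tau> \<noteq> 0" for \<tau>
  proof (rule ccontr)
    assume "\<tau> \<notin> t ` I"
    then have empty: "{i \<in> I. t i = \<tau>} = {}"
      by blast
    show False
      using that(2) unfolding d[OF that(1)] empty by simp
  qed
  then have "{\<tau> \<in> T. d \<tau> \<noteq> 0} \<subseteq> t ` I"
    by blast
  then show "d \<in> carrier (mod_chains p T)"
    using d mod_in_carrier I unfolding mod_chains_iff
    by (metis d_def finite_imageI finite_subset restrict_extensional)
  have "evaluation p T \<phi> d = (\<Sum>\<tau>\<in>t ` I. \<phi> \<tau> * d \<tau>) mod int p"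
    using I t supp by (intro evaluation_superset) auto
  also have "\<dots> = (\<Sum>\<tau>\<in>t ` I. \<phi> \<tau> * (\<Sum>i\<in>{i \<in> I. t i = \<tau>}. w i)) mod int p"
  proof (rule sum_mod_cong)
    fix \<tau> assume "\<tau> \<in> t ` I"
    then have "\<tau> \<in> T"
      using t by blast
    then show "\<phi> \<tau> * d \<tau> mod int p = \<phi> \<tau> * (\<Sum>i\<in>{i \<in> I. t i = \<tau>}. w i) mod int p"
      by (simp only: d mod_mult_right_eq)
  qed
  also have "(\<Sum>\<tau>\<in>t ` I. \<phi> \<tau> * (\<Sum>i\<in>{i \<in> I. t i = \<tau>}. w i))
      = (\<Sum>\<tau>\<in>t ` I. \<Sum>i\<in>{i \<in> I. t i = \<tau>}. \<phi> (t i) * w i)"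
    by (intro sum.cong) (auto simp: sum_distrib_left)
  also have "\<dots> = (\<Sum>i\<in>I. \<phi> (t i) * w i)"
    using I by (rule sum.image_gen[symmetric])
  finally show "evaluation p T \<phi> d = (\<Sum>i\<in>I. \<phi> (t i) * w i) mod int p" .
qed

end

section \<open>Singular chains and cochains\<close>

lemma coeff_chain_group_eq:
  "coeff_chain_group (integer_mod_group p) n X = mod_chains p (singular_simplex_set n X)"
  by (simp add: coeff_chain_group_def)

lemma coeff_cochain_group_eq:
  "coeff_cochain_group (integer_mod_group p) n X = mod_cochains p (singular_simplex_set n X)"
  by (simp add: coeff_cochain_group_def)

lemma coeff_support_eq:
  "coeff_support (integer_mod_group p) n X c = {\<sigma> \<in> singular_simplex_set n X. c \<sigma> \<noteq> 0}"
  by (simp add: coeff_support_def)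

context
  fixes p :: nat
  assumes p: "prime p"
begin

abbreviation (input) "Zmod \<equiv> integer_mod_group p"

section \<open>Boundary and chain map as adjoints of coboundary and pullback\<close>

lemma coeff_cochain_map_closed:
  assumes "continuous_map X Y f" "\<phi> \<in> carrier (mod_cochains p (singular_simplex_set n Y))"
  shows "coeff_cochain_map n X f \<phi> \<in> carrier (mod_cochains p (singular_simplex_set n X))"
  using assms(2) singular_simplex_simplex_map[OF _ assms(1)]
  unfolding mod_cochains_iff coeff_cochain_map_def by auto

lemma coeff_coboundary_apply:
  assumes "\<phi> \<in> carrier (mod_cochains p (singular_simplex_set n X))"
    and "\<sigma> \<in> singular_simplex_set (Suc n) X"
  shows "coeff_coboundary Zmod n X \<phi> \<sigma>
    = (\<Sum>k\<le>Suc n. (-1) ^ k * \<phi> (singular_face (Suc n) k \<sigma>)) mod int p"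
proof -
  have "coeff_coboundary Zmod n X \<phi> \<sigma> = (\<Sum>k\<le>Suc n. ((-1) ^ k * \<phi> (singular_face (Suc n) k \<sigma>)) mod int p) mod int p"
    unfolding coeff_coboundary_def restrict_apply'[OF assms(2)] int_pow_integer_mod_group
    by (intro finprod_integer_mod_group mod_in_carrier[OF p] finite_atMost)
  then show ?thesis
    by (simp only: mod_sum_eq)
qed

lemma coeff_coboundary_closed:
  assumes "\<phi> \<in> carrier (mod_cochains p (singular_simplex_set n X))"
  shows "coeff_coboundary Zmod n X \<phi> \<in> carrier (mod_cochains p (singular_simplex_set (Suc n) X))"
  unfolding mod_cochains_iff
proof
  show "coeff_coboundary Zmod n X \<phi> \<in> extensional (singular_simplex_set (Suc n) X)"
    unfolding coeff_coboundary_def by (rule restrict_extensional)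
  show "\<forall>\<sigma>\<in>singular_simplex_set (Suc n) X. coeff_coboundary Zmod n X \<phi> \<sigma> \<in> carrier Zmod"
    using coeff_coboundary_apply[OF assms] mod_in_carrier[OF p] by metis
qed

text \<open>Faces precompose and \<open>f\<close> postcomposes, so they commute; only the
  restrictions to standard simplices have to be matched.\<close>

lemma coeff_coboundary_cochain_map:
  assumes "continuous_map X Y f" "\<phi> \<in> carrier (mod_cochains p (singular_simplex_set n Y))"
  shows "coeff_coboundary Zmod n X (coeff_cochain_map n X f \<phi>)
    = coeff_cochain_map (Suc n) X f (coeff_coboundary Zmod n Y \<phi>)"
proof (rule extensionalityI[of _ "singular_simplex_set (Suc n) X"])
  fix \<sigma> assume \<sigma>: "\<sigma> \<in> singular_simplex_set (Suc n) X"
  then have f\<sigma>: "simplex_map (Suc n) f \<sigma> \<in> singular_simplex_set (Suc n) Y"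
    using assms(1) singular_simplex_simplex_map by blast
  have "coeff_cochain_map n X f \<phi> (singular_face (Suc n) k \<sigma>)
      = \<phi> (singular_face (Suc n) k (simplex_map (Suc n) f \<sigma>))" if k: "k \<le> Suc n" for k
  proof -
    have "singular_face (Suc n) k \<sigma> \<in> singular_simplex_set n X"
      using \<sigma> k singular_simplex_singular_face[of "Suc n" X \<sigma> k] by simp
    moreover have "singular_face (Suc n) k (simplex_map (Suc n) f \<sigma>) = simplex_map n f (singular_face (Suc n) k \<sigma>)"
      using k singular_face_simplex_map[of "Suc n" k f \<sigma>]
      by (simp add: simplex_map_def singular_face_def restrict_def fun_eq_iff)
    ultimately show ?thesis
      by (simp add: coeff_cochain_map_def)
  qed
  then have "(\<Sum>k\<le>Suc n. (-1) ^ k * coeff_cochain_map n X f \<phi> (singular_face (Suc n) k \<sigma>))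
      = (\<Sum>k\<le>Suc n. (-1) ^ k * \<phi> (singular_face (Suc n) k (simplex_map (Suc n) f \<sigma>)))"
    by (intro sum.cong refl) (simp only: atMost_iff)
  then show "coeff_coboundary Zmod n X (coeff_cochain_map n X f \<phi>) \<sigma>
      = coeff_cochain_map (Suc n) X f (coeff_coboundary Zmod n Y \<phi>) \<sigma>"
    by (simp only: coeff_coboundary_apply[OF coeff_cochain_map_closed[OF assms] \<sigma>]
        coeff_cochain_map_def[of "Suc n"] restrict_apply'[OF \<sigma>] coeff_coboundary_apply[OF assms(2) f\<sigma>])
qed (auto simp: coeff_coboundary_def coeff_cochain_map_def)

lemma
  assumes c: "c \<in> carrier (mod_chains p (singular_simplex_set n X))" and f: "continuous_map X Y f"
  shows coeff_chain_map_closed: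
      "coeff_chain_map Zmod n X Y f c \<in> carrier (mod_chains p (singular_simplex_set n Y))"
    and evaluation_coeff_chain_map:
      "evaluation p (singular_simplex_set n Y) \<phi> (coeff_chain_map Zmod n X Y f c)
        = evaluation p (singular_simplex_set n X) (coeff_cochain_map n X f \<phi>) c"
proof -
  let ?I = "{\<sigma> \<in> singular_simplex_set n X. c \<sigma> \<noteq> 0}"
  have I: "finite ?I" "\<And>\<sigma>. \<sigma> \<in> ?I \<Longrightarrow> c \<sigma> \<in> carrier Zmod"
    using c unfolding mod_chains_iff by blast+
  have t: "simplex_map n f \<sigma> \<in> singular_simplex_set n Y" if "\<sigma> \<in> ?I" for \<sigma>
    using that f singular_simplex_simplex_map by blast
  note pf = pushforward[OF p I(1) t I(2)]
  show "coeff_chain_map Zmod n X Y f c \<in> carrier (mod_chains p (singular_simplex_set n Y))"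
    unfolding coeff_chain_map_def coeff_support_eq by (rule pf(1))
  have "evaluation p (singular_simplex_set n Y) \<phi> (coeff_chain_map Zmod n X Y f c)
      = (\<Sum>\<sigma>\<in>?I. \<phi> (simplex_map n f \<sigma>) * c \<sigma>) mod int p"
    unfolding coeff_chain_map_def coeff_support_eq by (rule pf(2))
  also have "\<dots> = evaluation p (singular_simplex_set n X) (coeff_cochain_map n X f \<phi>) c"
    unfolding evaluation_def by (intro arg_cong[where f = "\<lambda>x. x mod int p"] sum.cong)
      (auto simp: coeff_cochain_map_def)
  finally show "evaluation p (singular_simplex_set n Y) \<phi> (coeff_chain_map Zmod n X Y f c)
      = evaluation p (singular_simplex_set n X) (coeff_cochain_map n X f \<phi>) c" .
qed

text \<open>\<open>pushforward\<close> applies with the pairs of a simplex in the support and a face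
  number, weighted by signed coefficients. Summing over the face number first produces the
  coboundary.\<close>

lemma
  assumes c: "c \<in> carrier (mod_chains p (singular_simplex_set (Suc n) X))"
  shows coeff_boundary_closed:
      "coeff_boundary Zmod (Suc n) X c \<in> carrier (mod_chains p (singular_simplex_set n X))"
    and evaluation_coeff_boundary:
      "\<phi> \<in> carrier (mod_cochains p (singular_simplex_set n X)) \<Longrightarrow>
        evaluation p (singular_simplex_set n X) \<phi> (coeff_boundary Zmod (Suc n) X c)
        = evaluation p (singular_simplex_set (Suc n) X) (coeff_coboundary Zmod n X \<phi>) c"
proof -
  let ?A = "{\<sigma> \<in> singular_simplex_set (Suc n) X. c \<sigma> \<noteq> 0}"
  let ?I = "?A \<times> {..Suc n}"
  let ?t = "\<lambda>(\<sigma>, k). singular_face (Suc n) k \<sigma>"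
  let ?w = "\<lambda>(\<sigma>, k::nat). c \<sigma> [^]\<^bsub>Zmod\<^esub> ((-1) ^ k :: int)"
  have I: "finite ?I"
    using c unfolding mod_chains_iff by blast
  have t: "?t i \<in> singular_simplex_set n X" if "i \<in> ?I" for i
    using that singular_simplex_singular_face[of "Suc n" X] by auto
  have w: "?w i \<in> carrier Zmod" if "i \<in> ?I" for i
    using mod_in_carrier[OF p] by (auto simp: int_pow_integer_mod_group split: prod.split)
  have set_eq: "{(\<sigma>, k). \<sigma> \<in> coeff_support Zmod (Suc n) X c \<and> k \<le> Suc n \<and> singular_face (Suc n) k \<sigma> = \<tau>}
      = {i \<in> ?I. ?t i = \<tau>}" for \<tau>
    by (auto simp: coeff_support_eq)
  have eq: "coeff_boundary Zmod (Suc n) X c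
      = (\<lambda>\<tau>\<in>singular_simplex_set n X. finprod Zmod ?w {i \<in> ?I. ?t i = \<tau>})"
    unfolding coeff_boundary_def set_eq by simp
  note pf = pushforward[OF p I t w]
  show "coeff_boundary Zmod (Suc n) X c \<in> carrier (mod_chains p (singular_simplex_set n X))"
    unfolding eq by (rule pf(1))
  assume \<phi>: "\<phi> \<in> carrier (mod_cochains p (singular_simplex_set n X))"
  have "evaluation p (singular_simplex_set n X) \<phi> (coeff_boundary Zmod (Suc n) X c)
      = (\<Sum>i\<in>?I. \<phi> (?t i) * ?w i) mod int p"
    unfolding eq by (rule pf(2))
  also have "(\<Sum>i\<in>?I. \<phi> (?t i) * ?w i)
      = (\<Sum>\<sigma>\<in>?A. \<Sum>k\<le>Suc n. \<phi> (singular_face (Suc n) k \<sigma>) * (((-1) ^ k * c \<sigma>) mod int p))"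
    unfolding sum.cartesian_product by (rule sum.cong) (auto simp: int_pow_integer_mod_group)
  also have "\<dots> mod int p = (\<Sum>\<sigma>\<in>?A. coeff_coboundary Zmod n X \<phi> \<sigma> * c \<sigma>) mod int p"
  proof (rule sum_mod_cong)
    fix \<sigma> assume \<sigma>: "\<sigma> \<in> ?A"
    have "(\<Sum>k\<le>Suc n. \<phi> (singular_face (Suc n) k \<sigma>) * (((-1) ^ k * c \<sigma>) mod int p)) mod int p
        = (\<Sum>k\<le>Suc n. \<phi> (singular_face (Suc n) k \<sigma>) * ((-1) ^ k * c \<sigma>)) mod int p"
      by (intro sum_mod_cong) (simp only: mod_mult_right_eq)
    also have "\<dots> = ((\<Sum>k\<le>Suc n. (-1) ^ k * \<phi> (singular_face (Suc n) k \<sigma>)) * c \<sigma>) mod int p"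
      unfolding sum_distrib_right by (simp only: mult_ac)
    also have "\<dots> = (coeff_coboundary Zmod n X \<phi> \<sigma> * c \<sigma>) mod int p"
      using \<sigma> coeff_coboundary_apply[OF \<phi>, of \<sigma>] by (simp only: mem_Collect_eq mod_mult_left_eq)
    finally show "(\<Sum>k\<le>Suc n. \<phi> (singular_face (Suc n) k \<sigma>) * (((-1) ^ k * c \<sigma>) mod int p)) mod int p
        = (coeff_coboundary Zmod n X \<phi> \<sigma> * c \<sigma>) mod int p" .
  qed
  also have "\<dots> = evaluation p (singular_simplex_set (Suc n) X) (coeff_coboundary Zmod n X \<phi>) c"
    by (simp only: evaluation_def)
  finally show "evaluation p (singular_simplex_set n X) \<phi> (coeff_boundary Zmod (Suc n) X c)
      = evaluation p (singular_simplex_set (Suc n) X) (coeff_coboundary Zmod n X \<phi>) c" .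
qed

lemma hom_coeff_boundary:
  "coeff_boundary Zmod (Suc n) X
    \<in> hom (mod_chains p (singular_simplex_set (Suc n) X)) (mod_chains p (singular_simplex_set n X))"
  by (rule hom_of_adjoint[OF p coeff_boundary_closed evaluation_coeff_boundary])

lemma hom_coeff_chain_map:
  assumes "continuous_map X Y f"
  shows "coeff_chain_map Zmod n X Y f
    \<in> hom (mod_chains p (singular_simplex_set n X)) (mod_chains p (singular_simplex_set n Y))"
  using hom_of_adjoint[OF p coeff_chain_map_closed[OF _ assms] evaluation_coeff_chain_map[OF _ assms]] .

lemma hom_coeff_cochain_map:
  assumes "continuous_map X Y f"
  shows "coeff_cochain_map n X f
    \<in> hom (mod_cochains p (singular_simplex_set n Y)) (mod_cochains p (singular_simplex_set n X))"
proof (rule homI)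
  show "coeff_cochain_map n X f (\<phi> \<otimes>\<^bsub>mod_cochains p (singular_simplex_set n Y)\<^esub> \<psi>)
      = coeff_cochain_map n X f \<phi> \<otimes>\<^bsub>mod_cochains p (singular_simplex_set n X)\<^esub> coeff_cochain_map n X f \<psi>" for \<phi> \<psi>
    using singular_simplex_simplex_map[OF _ assms]
    by (auto simp: coeff_cochain_map_def fun_eq_iff)
qed (rule coeff_cochain_map_closed[OF assms])

text \<open>The adjoint of \<open>coeff_coboundary_cochain_map\<close>: both sides pair equally with
  every cochain.\<close>

lemma coeff_boundary_chain_map:
  assumes f: "continuous_map X Y f" and c: "c \<in> carrier (mod_chains p (singular_simplex_set (Suc n) X))"
  shows "coeff_chain_map Zmod n X Y f (coeff_boundary Zmod (Suc n) X c)
    = coeff_boundary Zmod (Suc n) Y (coeff_chain_map Zmod (Suc n) X Y f c)"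
proof (rule chain_eqI[OF p])
  show "coeff_chain_map Zmod n X Y f (coeff_boundary Zmod (Suc n) X c) \<in> carrier (mod_chains p (singular_simplex_set n Y))"
    by (rule coeff_chain_map_closed[OF coeff_boundary_closed[OF c] f])
  show "coeff_boundary Zmod (Suc n) Y (coeff_chain_map Zmod (Suc n) X Y f c) \<in> carrier (mod_chains p (singular_simplex_set n Y))"
    by (rule coeff_boundary_closed[OF coeff_chain_map_closed[OF c f]])
  fix \<phi> assume \<phi>: "\<phi> \<in> carrier (mod_cochains p (singular_simplex_set n Y))"
  show "evaluation p (singular_simplex_set n Y) \<phi> (coeff_chain_map Zmod n X Y f (coeff_boundary Zmod (Suc n) X c))
      = evaluation p (singular_simplex_set n Y) \<phi> (coeff_boundary Zmod (Suc n) Y (coeff_chain_map Zmod (Suc n) X Y f c))"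
    by (simp only: evaluation_coeff_chain_map[OF coeff_boundary_closed[OF c] f]
        evaluation_coeff_boundary[OF c coeff_cochain_map_closed[OF f \<phi>]]
        evaluation_coeff_boundary[OF coeff_chain_map_closed[OF c f] \<phi>]
        evaluation_coeff_chain_map[OF c f] coeff_coboundary_cochain_map[OF f \<phi>])
qed

lemma coeff_augmentation_eq:
  assumes "c \<in> carrier (mod_chains p (singular_simplex_set 0 X))"
  shows "coeff_augmentation Zmod X c = evaluation p (singular_simplex_set 0 X) (coeff_coaugmentation X 1) c"
proof -
  have "coeff_augmentation Zmod X c = (\<Sum>\<sigma>\<in>{\<sigma> \<in> singular_simplex_set 0 X. c \<sigma> \<noteq> 0}. c \<sigma>) mod int p"
    unfolding coeff_augmentation_def coeff_support_eq using assms unfolding mod_chains_iff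
    by (intro finprod_integer_mod_group) auto
  then show ?thesis
    unfolding evaluation_def coeff_coaugmentation_def by simp
qed

text \<open>Augmentation and coaugmentation are adjoint, with the coefficient group acting as chains
  of degree -1. This is the degree 0 counterpart of
  \<open>evaluation_coeff_boundary\<close>.\<close>

lemma evaluation_coaugmentation:
  assumes "c \<in> carrier (mod_chains p (singular_simplex_set 0 X))"
  shows "evaluation p (singular_simplex_set 0 X) (coeff_coaugmentation X g) c
    = (g * coeff_augmentation Zmod X c) mod int p"
  unfolding coeff_augmentation_eq[OF assms] evaluation_def coeff_coaugmentation_def
  by (simp add: sum_distrib_left mod_mult_right_eq)

section \<open>Cycles, boundaries, cocycles and coboundaries as annihilators\<close>

context
  fixes n :: nat and X :: "'a topology"
begin

interpretation E: perfect_pairing "mod_chains p (singular_simplex_set n X)" p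
    "mod_cochains p (singular_simplex_set n X)" "evaluation p (singular_simplex_set n X)"
  by (rule perfect_pairing_evaluation[OF p])

text \<open>The boundary of \<open>c\<close> vanishes iff all cochains kill it, which by adjointness
  means that all coboundaries kill \<open>c\<close>.\<close>

lemma reduced_cycles_eq_coannihilator:
  "coeff_reduced_cycles Zmod n X = E.coannihilator (coeff_reduced_coboundaries Zmod n X)"
proof (cases n)
  case 0
  have "coeff_augmentation Zmod X c = 0 \<longleftrightarrow>
      (\<forall>g\<in>carrier Zmod. evaluation p (singular_simplex_set 0 X) (coeff_coaugmentation X g) c = 0)"
    if c: "c \<in> carrier (mod_chains p (singular_simplex_set 0 X))" for c
  proof -
    \<comment> \<open>Testing with the constant cochain 1 suffices: it gives the augmentation, and
      the other constants give its multiples.\<close>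
    have "1 \<in> carrier Zmod"
      using prime_gt_1_nat[OF p] by (simp add: carrier_mod[OF p])
    then show ?thesis
      unfolding coeff_augmentation_eq[OF c] using evaluation_coaugmentation[OF c]
      by (metis coeff_augmentation_eq[OF c] mod_0 mult_zero_right)
  qed
  then show ?thesis
    unfolding E.coannihilator_def coeff_reduced_cycles_def coeff_reduced_coboundaries_def kernel_def
      coeff_chain_group_eq one_integer_mod_group using 0 by auto
next
  case (Suc m)
  have "coeff_boundary Zmod (Suc m) X c = \<one>\<^bsub>mod_chains p (singular_simplex_set m X)\<^esub> \<longleftrightarrow>
      (\<forall>\<phi>\<in>carrier (mod_cochains p (singular_simplex_set m X)).
        evaluation p (singular_simplex_set (Suc m) X) (coeff_coboundary Zmod m X \<phi>) c = 0)"
    if c: "c \<in> carrier (mod_chains p (singular_simplex_set (Suc m) X))" for c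
  proof -
    have one: "\<one>\<^bsub>mod_chains p (singular_simplex_set m X)\<^esub> \<in> carrier (mod_chains p (singular_simplex_set m X))"
      by (intro monoid.one_closed group.is_monoid) simp
    have zero: "evaluation p (singular_simplex_set m X) \<phi> \<one>\<^bsub>mod_chains p (singular_simplex_set m X)\<^esub> = 0" for \<phi>
      by (simp add: evaluation_def)
    show ?thesis
      using chain_eqI[OF p coeff_boundary_closed[OF c] one] evaluation_coeff_boundary[OF c] zero by metis
  qed
  then show ?thesis
    unfolding E.coannihilator_def coeff_reduced_cycles_def coeff_reduced_coboundaries_def kernel_def
      coeff_chain_group_eq coeff_cochain_group_eq using Suc by auto
qed

lemma reduced_coboundaries_subset:
  "coeff_reduced_coboundaries Zmod n X \<subseteq> carrier (mod_cochains p (singular_simplex_set n X))"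
proof (cases n)
  case 0
  have "coeff_coaugmentation X g \<in> carrier (mod_cochains p (singular_simplex_set 0 X))"
    if "g \<in> carrier Zmod" for g
    using that unfolding mod_cochains_iff coeff_coaugmentation_def by simp
  then show ?thesis
    unfolding coeff_reduced_coboundaries_def 0 by auto
next
  case (Suc m)
  then show ?thesis
    unfolding coeff_reduced_coboundaries_def coeff_cochain_group_eq
    using coeff_coboundary_closed by auto
qed

lemma subgroup_reduced_cycles:
  "subgroup (coeff_reduced_cycles Zmod n X) (mod_chains p (singular_simplex_set n X))"
  unfolding reduced_cycles_eq_coannihilator
  by (rule E.subgroup_coannihilator[OF reduced_coboundaries_subset])

lemma subgroup_boundaries:
  "subgroup (coeff_boundaries Zmod n X) (mod_chains p (singular_simplex_set n X))"
proof -
  interpret group_hom "mod_chains p (singular_simplex_set (Suc n) X)"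
    "mod_chains p (singular_simplex_set n X)" "coeff_boundary Zmod (Suc n) X"
    using hom_coeff_boundary by (simp add: group_hom_def group_hom_axioms_def)
  show ?thesis
    unfolding coeff_boundaries_def coeff_chain_group_eq by (rule img_is_subgroup)
qed

text \<open>The substantial inclusion: a cochain that kills the kernel of the boundary descends to
  its image, extends to all chains one degree lower, and is the coboundary of the cochain
  representing that extension.\<close>

lemma reduced_coboundaries_eq_annihilator:
  "coeff_reduced_coboundaries Zmod n X = E.annihilator (coeff_reduced_cycles Zmod n X)"
proof
  show "coeff_reduced_coboundaries Zmod n X \<subseteq> E.annihilator (coeff_reduced_cycles Zmod n X)"
    using reduced_coboundaries_subset
    unfolding reduced_cycles_eq_coannihilator E.annihilator_def E.coannihilator_def by blast
  show "E.annihilator (coeff_reduced_cycles Zmod n X) \<subseteq> coeff_reduced_coboundaries Zmod n X"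
  proof
    fix \<phi> assume "\<phi> \<in> E.annihilator (coeff_reduced_cycles Zmod n X)"
    then have \<phi>: "\<phi> \<in> carrier (mod_cochains p (singular_simplex_set n X))"
      and zero: "\<And>c. c \<in> coeff_reduced_cycles Zmod n X \<Longrightarrow> evaluation p (singular_simplex_set n X) \<phi> c = 0"
      unfolding E.annihilator_def by blast+
    show "\<phi> \<in> coeff_reduced_coboundaries Zmod n X"
    proof (cases n)
      case 0
      \<comment> \<open>In degree 0 the augmentation replaces the boundary, so the functional is
        extended over the coefficient group itself.\<close>
      interpret G: exponent_group Zmod p
        using p by (auto simp: exponent_group_def exponent_group_axioms_def)
      have aug: "coeff_augmentation Zmod X \<in> hom (mod_chains p (singular_simplex_set 0 X)) Zmod"
        using evaluation_add_right[OF p] evaluation_in_carrier[OF p] E.C.m_closed[unfolded 0]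
        by (intro homI) (auto simp: coeff_augmentation_eq simp del: mult_sum_group)
      have ker: "evaluation p (singular_simplex_set 0 X) \<phi> c = 0"
        if c: "c \<in> carrier (mod_chains p (singular_simplex_set 0 X))"
          and "coeff_augmentation Zmod X c \<in> {\<one>\<^bsub>Zmod\<^esub>}" for c
      proof -
        have "c \<in> coeff_reduced_cycles Zmod n X"
          using that unfolding coeff_reduced_cycles_def kernel_def coeff_chain_group_eq 0 by simp
        from zero[OF this] show ?thesis
          unfolding 0 .
      qed
      obtain h where h: "h \<in> hom Zmod Zmod" "\<And>x. x \<in> {\<one>\<^bsub>Zmod\<^esub>} \<Longrightarrow> h x = 0"
        "\<And>c. c \<in> carrier (mod_chains p (singular_simplex_set 0 X)) \<Longrightarrow>
          h (coeff_augmentation Zmod X c) = evaluation p (singular_simplex_set 0 X) \<phi> c"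
        by (rule G.functional_factors_through[OF E.C.is_group[unfolded 0] aug
            E.pairing_hom[OF \<phi>, unfolded 0] G.triv_subgroup ker]) (assumption+, rule that)
      have one: "1 \<in> carrier Zmod"
        using prime_gt_1_nat[OF p] by (simp add: carrier_mod[OF p])
      then have h1: "h 1 \<in> carrier Zmod"
        using h(1) unfolding hom_def by blast
      \<comment> \<open>An endomorphism of Z/p is multiplication by its value at 1; composed with
        the augmentation it evaluates the constant cochain \<open>h 1\<close>.\<close>
      have h_eq: "h g = (h 1 * g) mod int p" if "g \<in> carrier Zmod" for g
        using hom_integer_mod_group_int_pow[OF _ h(1) one, of g] that
        by (simp add: int_pow_integer_mod_group carrier_mod_trivial[OF p] mult.commute)
      have co: "coeff_coaugmentation X (h 1) \<in> coeff_reduced_coboundaries Zmod n X"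
        using h1 unfolding coeff_reduced_coboundaries_def 0 by simp
      have "\<phi> = coeff_coaugmentation X (h 1)"
      proof (rule cochain_eqI[OF p \<phi>])
        show "coeff_coaugmentation X (h 1) \<in> carrier (mod_cochains p (singular_simplex_set n X))"
          using co reduced_coboundaries_subset by blast
        fix c assume "c \<in> carrier (mod_chains p (singular_simplex_set n X))"
        then have c: "c \<in> carrier (mod_chains p (singular_simplex_set 0 X))"
          unfolding 0 .
        have "coeff_augmentation Zmod X c \<in> carrier Zmod"
          using evaluation_in_carrier[OF p] coeff_augmentation_eq[OF c] by metis
        then show "evaluation p (singular_simplex_set n X) \<phi> c
            = evaluation p (singular_simplex_set n X) (coeff_coaugmentation X (h 1)) c"
          unfolding 0 by (simp only: evaluation_coaugmentation[OF c] h_eq flip: h(3)[OF c])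
      qed
      then show ?thesis
        using co by simp
    next
      case (Suc m)
      interpret F: perfect_pairing "mod_chains p (singular_simplex_set m X)" p
          "mod_cochains p (singular_simplex_set m X)" "evaluation p (singular_simplex_set m X)"
        by (rule perfect_pairing_evaluation[OF p])
      have ker: "evaluation p (singular_simplex_set (Suc m) X) \<phi> c = 0"
        if c: "c \<in> carrier (mod_chains p (singular_simplex_set (Suc m) X))"
          and "coeff_boundary Zmod (Suc m) X c \<in> {\<one>\<^bsub>mod_chains p (singular_simplex_set m X)\<^esub>}" for c
      proof -
        have "c \<in> coeff_reduced_cycles Zmod n X"
          using that unfolding coeff_reduced_cycles_def kernel_def coeff_chain_group_eq Suc by simp
        from zero[OF this] show ?thesis
          unfolding Suc .
      qed
      \<comment> \<open>The factorisation is used with the trivial subgroup as \<open>B\<close>, so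
        its kernel condition is exactly vanishing on cycles.\<close>
      obtain h where h: "h \<in> hom (mod_chains p (singular_simplex_set m X)) Zmod"
        "\<And>x. x \<in> {\<one>\<^bsub>mod_chains p (singular_simplex_set m X)\<^esub>} \<Longrightarrow> h x = 0"
        "\<And>c. c \<in> carrier (mod_chains p (singular_simplex_set (Suc m) X)) \<Longrightarrow>
          h (coeff_boundary Zmod (Suc m) X c) = evaluation p (singular_simplex_set (Suc m) X) \<phi> c"
        by (rule F.C.functional_factors_through[OF E.C.is_group[unfolded Suc] hom_coeff_boundary
            E.pairing_hom[OF \<phi>, unfolded Suc] F.C.triv_subgroup ker]) (assumption+, rule that)
      obtain \<psi> where \<psi>: "\<psi> \<in> carrier (mod_cochains p (singular_simplex_set m X))"
        "\<And>c. c \<in> carrier (mod_chains p (singular_simplex_set m X)) \<Longrightarrow> evaluation p (singular_simplex_set m X) \<psi> c = h c"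
        using F.pairing_represents[OF h(1)] by blast
      have "\<phi> = coeff_coboundary Zmod m X \<psi>"
      proof (rule cochain_eqI[OF p \<phi>[unfolded Suc] coeff_coboundary_closed[OF \<psi>(1)]])
        fix c assume c: "c \<in> carrier (mod_chains p (singular_simplex_set (Suc m) X))"
        show "evaluation p (singular_simplex_set (Suc m) X) \<phi> c
            = evaluation p (singular_simplex_set (Suc m) X) (coeff_coboundary Zmod m X \<psi>) c"
          using h(3)[OF c] \<psi>(2)[OF coeff_boundary_closed[OF c]] evaluation_coeff_boundary[OF c \<psi>(1)]
          by simp
      qed
      then show ?thesis
        using \<psi>(1) unfolding coeff_reduced_coboundaries_def coeff_cochain_group_eq Suc by simp
    qed
  qed
qed

text \<open>Adjointness again, now with chains separating cochains.\<close>

lemma cocycles_eq_annihilator: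
  "coeff_cocycles Zmod n X = E.annihilator (coeff_boundaries Zmod n X)"
proof -
  have "coeff_coboundary Zmod n X \<phi> = \<one>\<^bsub>mod_cochains p (singular_simplex_set (Suc n) X)\<^esub> \<longleftrightarrow>
      (\<forall>c\<in>carrier (mod_chains p (singular_simplex_set (Suc n) X)).
        evaluation p (singular_simplex_set n X) \<phi> (coeff_boundary Zmod (Suc n) X c) = 0)"
    if \<phi>: "\<phi> \<in> carrier (mod_cochains p (singular_simplex_set n X))" for \<phi>
  proof -
    let ?one = "\<one>\<^bsub>mod_cochains p (singular_simplex_set (Suc n) X)\<^esub>"
    have one: "?one \<in> carrier (mod_cochains p (singular_simplex_set (Suc n) X))"
      by (intro monoid.one_closed group.is_monoid) simp
    have zero: "evaluation p (singular_simplex_set (Suc n) X) ?one c = 0" for c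
      unfolding evaluation_def by simp
    show ?thesis
      using cochain_eqI[OF p coeff_coboundary_closed[OF \<phi>] one] evaluation_coeff_boundary[OF _ \<phi>] zero
      by metis
  qed
  then show ?thesis
    unfolding coeff_cocycles_def kernel_def E.annihilator_def coeff_boundaries_def
      coeff_chain_group_eq coeff_cochain_group_eq by blast
qed

lemma cochain_map_reduced_coboundaries:
  assumes f: "continuous_map X X f"
  shows "coeff_cochain_map n X f ` coeff_reduced_coboundaries Zmod n X \<subseteq> coeff_reduced_coboundaries Zmod n X"
proof (cases n)
  case 0
  have "coeff_cochain_map 0 X f (coeff_coaugmentation X g) = coeff_coaugmentation X g" for g :: int
    using singular_simplex_simplex_map[OF _ f]
    by (auto simp: coeff_cochain_map_def coeff_coaugmentation_def fun_eq_iff)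
  then show ?thesis
    unfolding coeff_reduced_coboundaries_def 0 by auto
next
  case (Suc m)
  then show ?thesis
    unfolding coeff_reduced_coboundaries_def coeff_cochain_group_eq
    using coeff_coboundary_cochain_map[OF f, symmetric] coeff_cochain_map_closed[OF f] by auto
qed

theorem homology_iso_iff_cohomology_iso:
  assumes f: "continuous_map X X f"
  shows "homology_induced Zmod n X X f
      \<in> iso (coeff_reduced_homology Zmod n X) (coeff_reduced_homology Zmod n X)
    \<longleftrightarrow> cohomology_induced Zmod n X f
      \<in> iso (coeff_reduced_cohomology Zmod n X) (coeff_reduced_cohomology Zmod n X)"
proof -
  \<comment> \<open>Cycles are described by the coboundaries they are killed by, so their invariance
    follows from that of the coboundaries under pullback, uniformly in all degrees.\<close>
  have cycles: "coeff_chain_map Zmod n X X f ` coeff_reduced_cycles Zmod n X \<subseteq> coeff_reduced_cycles Zmod n X"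
  proof (rule image_subsetI)
    fix c assume "c \<in> coeff_reduced_cycles Zmod n X"
    then have c: "c \<in> carrier (mod_chains p (singular_simplex_set n X))"
      and "\<And>\<phi>. \<phi> \<in> coeff_reduced_coboundaries Zmod n X \<Longrightarrow> evaluation p (singular_simplex_set n X) \<phi> c = 0"
      unfolding reduced_cycles_eq_coannihilator E.coannihilator_def by blast+
    then show "coeff_chain_map Zmod n X X f c \<in> coeff_reduced_cycles Zmod n X"
      unfolding reduced_cycles_eq_coannihilator E.coannihilator_def
      using coeff_chain_map_closed[OF c f] evaluation_coeff_chain_map[OF c f]
        cochain_map_reduced_coboundaries[OF f] by auto
  qed
  have boundaries: "coeff_chain_map Zmod n X X f ` coeff_boundaries Zmod n X \<subseteq> coeff_boundaries Zmod n X"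
    unfolding coeff_boundaries_def coeff_chain_group_eq
    using coeff_boundary_chain_map[OF f] coeff_chain_map_closed[OF _ f] by auto
  \<comment> \<open>With \<open>Z\<close> the cycles and \<open>B\<close> the boundaries, the
    annihilators are the coboundaries and the cocycles, so the dual quotient is literally reduced
    cohomology.\<close>
  from E.quotient_iso_iff_dual_iso[OF subgroup_reduced_cycles subgroup_boundaries
      hom_coeff_chain_map[OF f] hom_coeff_cochain_map[OF f]
      evaluation_coeff_chain_map[OF _ f, symmetric] cycles boundaries]
  show ?thesis
    unfolding homology_induced_def[abs_def] cohomology_induced_def[abs_def]
      coeff_reduced_homology_def coeff_reduced_cohomology_def coeff_chain_group_eq coeff_cochain_group_eq
      cocycles_eq_annihilator reduced_coboundaries_eq_annihilator .
qed

end

lemma cohomology_iso_classes_eq_homology_iso_classes: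
  "cohomology_iso_classes p k X x\<^sub>0 = homology_iso_classes p k X x\<^sub>0"
proof -
  \<comment> \<open>Both definitions quantify over all members of a class; each is homotopic to a
    representative and therefore continuous.\<close>
  have "continuous_map X X f" if "A \<in> carrier (self_map_classes X x\<^sub>0)" "f \<in> A" for A f
    using that by (auto simp: self_map_classes_def quotient_def based_homotopy_def
        dest: homotopic_with_imp_continuous_maps)
  then show ?thesis
    unfolding cohomology_iso_classes_def homology_iso_classes_def
    using homology_iso_iff_cohomology_iso by blast
qed

end

theorem proposition3p4:
  fixes p :: nat and X :: "'a topology" and x\<^sub>0 :: 'a
  assumes "prime p"
    and "CW_complex X"
    and "x\<^sub>0 \<in> topspace X"
    and "simply_connected_space X"
    and "p_local_space p X"
    and "\<And>n::nat. fin_gen_over_localized_integers p (reduced_homology_group (int n) X)"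
  shows "cohomology_self_closeness p X x\<^sub>0 = homology_self_closeness p X x\<^sub>0"
  unfolding cohomology_self_closeness_def homology_self_closeness_def
    cohomology_iso_classes_eq_homology_iso_classes[OF assms(1)] ..

end
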